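(* Let $K=\mathbb{F}_q$ be a finite field, let $a_1,a_2$ be positive integers, let $\mathbb{X}_i\subset\mathbb{P}^{a_i-1}$ be a non-empty subset of the projective space over $K$ for $i=1,2$, and let $\mathbb{X}\subset\mathbb{P}^{a_1a_2-1}$ be the Segre product of $\mathbb{X}_1$ and $\mathbb{X}_2$. Then the following hold. (a) $|\mathbb{X}|=|\mathbb{X}_1||\mathbb{X}_2|$. (b) $\dim_K(C_{\mathbb{X}}(d))=\dim_K(C_{\mathbb{X}_1}(d))\dim_K(C_{\mathbb{X}_2}(d))$ for $d\geq 1$. (c) $C_{\mathbb{X}}(d)$ is the direct product $C_{\mathbb{X}_1}(d)\,\underline{\otimes}\,C_{\mathbb{X}_2}(d)$ of $C_{\mathbb{X}_1}(d)$ and $C_{\mathbb{X}_2}(d)$ for $d\geq 1$ (where a vector of $K^{s_1s_2}$, $s_i=|\mathbb{X}_i|$, is regarded as an $s_1\times s_2$ matrix). (d) $\delta(C_{\mathbb{X}}(d))=\delta(C_{\mathbb{X}_1}(d))\,\delta(C_{\mathbb{X}_2}(d))$ for $d\geq 1$. (e) $\delta_2(C_{\mathbb{X}}(d))=\min\{\delta_1(C_{\mathbb{X}_1}(d))\,\delta_2(C_{\mathbb{X}_2}(d)),\ \delta_2(C_{\mathbb{X}_1}(d))\,\delta_1(C_{\mathbb{X}_2}(d))\}$ for $d\geq 1$. (f) $\delta(C_{\mathbb{X}}(d))=1$ for $d\geq\max\{\mathrm{reg}(K[\mathbf{x}]/I(\mathbb{X}_1)),\ \mathrm{reg}(K[\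mathbf{y}]/I(\mathbb{X}_2))\}$.
   Context: Polynomial rings: $K[\mathbf{x}]=K[x_1,\ldots,x_{a_1}]$, $K[\mathbf{y}]=K[y_1,\ldots,y_{a_2}]$, $K[\mathbf{t}]=K[t_{1,1},\ldots,t_{1,a_2},\ldots,t_{a_1,1},\ldots,t_{a_1,a_2}]$ have the standard grading; a subscript $d$ denotes the space of homogeneous polynomials of degree $d$ together with $0$. Segre product: the Segre embedding is the map $\psi\colon\mathbb{P}^{a_1-1}\times\mathbb{P}^{a_2-1}\to\mathbb{P}^{a_1a_2-1}$, $([(\alpha_1,\ldots,\alpha_{a_1})],[(\beta_1,\ldots,\beta_{a_2})])\mapsto[(\alpha_i\beta_j)]$, where the coordinates are ordered as $\alpha_1\beta_1,\ldots,\alpha_1\beta_{a_2},\ldots,\alpha_{a_1}\beta_1,\ldots,\alpha_{a_1}\beta_{a_2}$ (matching the order of the $t_{i,j}$). The Segre product of $\mathbb{X}_1$ and $\mathbb{X}_2$ is $\mathbb{X}=\psi(\mathbb{X}_1\times\mathbb{X}_2)$. Codes: put $s_i=|\mathbb{X}_i|$, $\mathbb{X}_1=\{Q_1,\ldots,Q_{s_1}\}$, $\mathbb{X}_2=\{R_1,\ldots,R_{s_2}\}$, with $Q_i=[(\alpha_{i,1},\ldots,\alpha_{i,a_1})]$, $R_j=[(\beta_{j,1},\ldots,\beta_{j,a_2})]$, and $P_{i,j}=\psi(Q_i,R_j)$. Let $k_i$ be the smallest $k$ with $\alpha_{i,k}\neq0$ and $\ell_j$ the smallest $\ell$ with $\beta_{j,\ell}\neq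 0$. Put $g_i=x_{k_i}^d$, $h_j=y_{\ell_j}^d$, $f_{i,j}=(t_{k_i,\ell_j})^d$; these do not vanish at $Q_i$, $R_j$, $P_{i,j}$ respectively. The projective Reed-Muller-type codes of degree $d$ are the images of the linear evaluation maps $C_{\mathbb{X}_1}(d)=\{(g(Q_1)/g_1(Q_1),\ldots,g(Q_{s_1})/g_{s_1}(Q_{s_1})) : g\in K[\mathbf{x}]_d\}\subset K^{s_1}$, $C_{\mathbb{X}_2}(d)=\{(h(R_1)/h_1(R_1),\ldots,h(R_{s_2})/h_{s_2}(R_{s_2})) : h\in K[\mathbf{y}]_d\}\subset K^{s_2}$, $C_{\mathbb{X}}(d)=\{(f(P_{1,1})/f_{1,1}(P_{1,1}),f(P_{1,2})/f_{1,2}(P_{1,2}),\ldots,f(P_{s_1,s_2})/f_{s_1,s_2}(P_{s_1,s_2})) : f\in K[\mathbf{t}]_d\}\subset K^{s_1s_2}$. (Each quotient is independent of the chosen representative of the point.) Vectors in $K^{s_1s_2}$ are identified with $s_1\times s_2$ matrices by letting the entry indexed by $P_{i,j}$ be the $(i,j)$ entry. Direct product: for linear codes $C_1\subset K^{s_1}$, $C_2\subset K^{s_2}$, $C_1\,\underline{\otimes}\,C_2$ is the linear code of all $s_1\times s_2$ matrices over $K$ whose rows belong to $C_2$ and whose columns belong to $C_1$. Weights: for a linear code $C\subset K^s$ and a linear subcode $D\subset C$, the support $\chi(D)$ is the set of $i$ such that some $(a_1,\ldots,a_s)\in D$ has $a_i\ne0$. The $r$th generalized Hamming weight is $\delta_r(C)=\min\{|\chi(D)|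 : D\subset C \text{ a linear subcode with }\dim_K D=r\}$, with the convention that $\delta_r(C)=\infty$ if $r>\dim_K C$. The minimum distance is $\delta(C)=\delta_1(C)$, the minimum number of non-zero entries of a non-zero vector of $C$. Regularity: for a non-empty subset $X$ of a projective space $\mathbb{P}^{s-1}$ over $K$ and $S=K[t_1,\ldots,t_s]$, the vanishing ideal $I(X)$ is the ideal of $S$ generated by the homogeneous polynomials vanishing at all points of $X$, $I(X)_d=I(X)\cap S_d$, $H_X(d)=\dim_K(S_d/I(X)_d)$ is the Hilbert function, and $h_X$ is the Hilbert polynomial (the unique polynomial with $h_X(d)=H_X(d)$ for $d\gg0$). The index of regularity $\mathrm{reg}(S/I(X))$ is the least integer $r\geq0$ such that $h_X(d)=H_X(d)$ for all $d\geq r$. *)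

theory Defs
  imports
    "HOL-Library.Poly_Mapping"
    "HOL-Library.Function_Algebras"
    "HOL-Library.Extended_Nat"
    "HOL-Computational_Algebra.Polynomial"
begin

text \<open>
  A monomial is a finitely supported exponent function, and a polynomial is a finitely supported
  map from monomials to coefficients.  The variables are indexed by elements of a type \<open>'v\<close>, and
  \<open>poly_ring V\<close> is the polynomial ring in the variables indexed by the set \<open>V\<close>:
  \<open>V = {1..a}\<close> for $x_1,\ldots,x_a$ and \<open>V = {1..a} \<times> {1..b}\<close> for $t_{1,1},\ldots,t_{a,b}$.
\<close>

type_synonym ('v, 'k) mpoly = "('v \<Rightarrow>\<^sub>0 nat) \<Rightarrow>\<^sub>0 'k"

definition var :: "'v \<Rightarrow> ('v, 'k::comm_ring_1) mpoly" where
  "var v = Poly_Mapping.single (Poly_Mapping.single v 1) 1"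

definition const :: "'k \<Rightarrow> ('v, 'k::comm_ring_1) mpoly" where
  "const c = Poly_Mapping.single 0 c"

definition eval_at :: "('v \<Rightarrow> 'k) \<Rightarrow> ('v, 'k::comm_ring_1) mpoly \<Rightarrow> 'k" where
  "eval_at u p = (\<Sum>m\<in>Poly_Mapping.keys p. Poly_Mapping.lookup p m *
     (\<Prod>v\<in>Poly_Mapping.keys m. u v ^ Poly_Mapping.lookup m v))"

definition poly_ring :: "'v set \<Rightarrow> ('v, 'k::comm_ring_1) mpoly set" where
  "poly_ring V = {p. \<forall>m\<in>Poly_Mapping.keys p. Poly_Mapping.keys m \<subseteq> V}"

definition mon_degree :: "('v \<Rightarrow>\<^sub>0 nat) \<Rightarrow> nat" where
  "mon_degree m = (\<Sum>v\<in>Poly_Mapping.keys m. Poly_Mapping.lookup m v)"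

definition homog :: "'v set \<Rightarrow> nat \<Rightarrow> ('v, 'k::comm_ring_1) mpoly set" where
  "homog V d = {p \<in> poly_ring V. \<forall>m\<in>Poly_Mapping.keys p. mon_degree m = d}"

definition ideal_generated ::
    "('v, 'k::comm_ring_1) mpoly set \<Rightarrow> ('v, 'k) mpoly set \<Rightarrow> ('v, 'k) mpoly set" where
  "ideal_generated S A =
     {\<Sum>f\<in>F. c f * f | F c. finite F \<and> F \<subseteq> A \<and> (\<forall>f\<in>F. c f \<in> S)}"

text \<open>\<open>coord_space I\<close> is $K^I$: functions on the index type that vanish off \<open>I\<close>.\<close>

definition coord_space :: "'i set \<Rightarrow> ('i \<Rightarrow> 'k::zero) set" where
  "coord_space I = {u. \<forall>i. i \<notin> I \<longrightarrow> u i = 0}"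

definition proj_rel :: "'v set \<Rightarrow> (('v \<Rightarrow> 'k::field) \<times> ('v \<Rightarrow> 'k)) set" where
  "proj_rel V = {(u, w). u \<in> coord_space V - {0} \<and> w \<in> coord_space V - {0} \<and>
                   (\<exists>c. c \<noteq> 0 \<and> w = (\<lambda>i. c * u i))}"

definition proj_space :: "'v set \<Rightarrow> ('v \<Rightarrow> 'k::field) set set" where
  "proj_space V = (coord_space V - {0}) // proj_rel V"

text \<open>
  The Segre map on classes.  By \<open>proj_rel\<close>-invariance all members of the union are the same class,
  so this is the class of $(\alpha_i \beta_j)$ for any representatives.
\<close>

definition segre ::
    "'v set \<Rightarrow> 'w set \<Rightarrow> ('v \<Rightarrow> 'k::field) set \<Rightarrow> ('w \<Rightarrow> 'k) set \<Rightarrow> ('v \<times> 'w \<Rightarrow> 'k) set" where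
  "segre V W p q = (\<Union>u\<in>p. \<Union>w\<in>q. proj_rel (V \<times> W) `` {\<lambda>(i, j). u i * w j})"

definition segre_product :: "nat \<Rightarrow> nat \<Rightarrow> (nat \<Rightarrow> 'k::field) set set \<Rightarrow> (nat \<Rightarrow> 'k) set set
    \<Rightarrow> (nat \<times> nat \<Rightarrow> 'k) set set" where
  "segre_product a1 a2 X1 X2 = (\<lambda>(p, q). segre {1..a1} {1..a2} p q) ` (X1 \<times> X2)"

text \<open>
  Vectors of $K^I$ and $I \times J$ matrices are functions vanishing off the index set.  The linear
  algebra is that of the pointwise vector space structure on the function type.
\<close>

definition vec_scale :: "'k::field \<Rightarrow> ('i \<Rightarrow> 'k) \<Rightarrow> 'i \<Rightarrow> 'k" where
  "vec_scale c v = (\<lambda>i. c * v i)"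

global_interpretation code: vector_space "vec_scale :: 'k::field \<Rightarrow> ('i \<Rightarrow> 'k) \<Rightarrow> 'i \<Rightarrow> 'k"
  by unfold_locales (auto simp: vec_scale_def fun_eq_iff algebra_simps)

definition code_support :: "('i \<Rightarrow> 'k::field) set \<Rightarrow> 'i set" where
  "code_support D = {i. \<exists>v\<in>D. v i \<noteq> 0}"

text \<open>In \<^typ>\<open>enat\<close> the infimum of a non-empty set is its minimum, and \<open>Inf {} = \<infinity>\<close>.\<close>

definition gen_hamming_weight :: "nat \<Rightarrow> ('i \<Rightarrow> 'k::field) set \<Rightarrow> enat" where
  "gen_hamming_weight r C =
     Inf {enat (card (code_support D)) | D. D \<subseteq> C \<and> code.subspace D \<and> code.dim D = r}"

definition min_distance :: "('i \<Rightarrow> 'k::field) set \<Rightarrow> enat" where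
  "min_distance C = gen_hamming_weight 1 C"

definition direct_product_code ::
    "'i set \<Rightarrow> 'j set \<Rightarrow> ('i \<Rightarrow> 'k::field) set \<Rightarrow> ('j \<Rightarrow> 'k) set \<Rightarrow> ('i \<times> 'j \<Rightarrow> 'k) set" where
  "direct_product_code I J C1 C2 =
     {M \<in> coord_space (I \<times> J). (\<forall>i\<in>I. (\<lambda>j. M (i, j)) \<in> C2) \<and> (\<forall>j\<in>J. (\<lambda>i. M (i, j)) \<in> C1)}"

definition rep :: "('v \<Rightarrow> 'k) set \<Rightarrow> 'v \<Rightarrow> 'k" where
  "rep p = (SOME u. u \<in> p)"

definition lead_index :: "(nat \<Rightarrow> 'k::field) set \<Rightarrow> nat" where
  "lead_index p = (LEAST k. rep p k \<noteq> 0)"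

text \<open>
  The points are \<open>P i\<close> for \<open>i \<in> I\<close>, and \<open>N i\<close> is the degree \<open>d\<close> form by which evaluation at
  \<open>P i\<close> is normalised; the quotients do not depend on the representative chosen by \<open>rep\<close>.
  Coordinates vanish off \<open>I\<close>, so this is a subset of \<open>coord_space I\<close>.
\<close>

definition evaluation_code :: "'v set \<Rightarrow> 'i set \<Rightarrow> ('i \<Rightarrow> ('v \<Rightarrow> 'k::field) set)
    \<Rightarrow> ('i \<Rightarrow> ('v, 'k) mpoly) \<Rightarrow> nat \<Rightarrow> ('i \<Rightarrow> 'k) set" where
  "evaluation_code V I P N d =
     (\<lambda>f i. if i \<in> I then eval_at (rep (P i)) f / eval_at (rep (P i)) (N i) else 0) ` homog V d"

definition RM_code :: "nat \<Rightarrow> nat \<Rightarrow> (nat \<Rightarrow> (nat \<Rightarrow> 'k::field) set) \<Rightarrow> nat \<Rightarrow> (nat \<Rightarrow> 'k) set" where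
  "RM_code a s Q d = evaluation_code {1..a} {1..s} Q (\<lambda>i. var (lead_index (Q i)) ^ d) d"

definition segre_RM_code :: "nat \<Rightarrow> nat \<Rightarrow> nat \<Rightarrow> nat \<Rightarrow> (nat \<Rightarrow> (nat \<Rightarrow> 'k::field) set)
    \<Rightarrow> (nat \<Rightarrow> (nat \<Rightarrow> 'k) set) \<Rightarrow> nat \<Rightarrow> (nat \<times> nat \<Rightarrow> 'k) set" where
  "segre_RM_code a1 a2 s1 s2 Q R d =
     evaluation_code ({1..a1} \<times> {1..a2}) ({1..s1} \<times> {1..s2})
       (\<lambda>(i, j). segre {1..a1} {1..a2} (Q i) (R j))
       (\<lambda>(i, j). var (lead_index (Q i), lead_index (R j)) ^ d) d"

definition vanishing_ideal :: "'v set \<Rightarrow> ('v \<Rightarrow> 'k::field) set set \<Rightarrow> ('v, 'k) mpoly set" where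
  "vanishing_ideal V X = ideal_generated (poly_ring V)
     {f. (\<exists>d. f \<in> homog V d) \<and> (\<forall>p\<in>X. \<forall>u\<in>p. eval_at u f = 0)}"

text \<open>
  The dimension of the quotient $A/B$ of $K$-vector spaces of polynomials: the size of a finite set
  of elements of $A$ whose classes are linearly independent in $A/B$ and span it.
\<close>

definition quotient_dim :: "('v, 'k::field) mpoly set \<Rightarrow> ('v, 'k) mpoly set \<Rightarrow> nat" where
  "quotient_dim A B = (THE n. \<exists>E. finite E \<and> E \<subseteq> A \<and> card E = n \<and>
     (\<forall>c. (\<Sum>e\<in>E. const (c e) * e) \<in> B \<longrightarrow> (\<forall>e\<in>E. c e = 0)) \<and>
     (\<forall>f\<in>A. \<exists>c. f - (\<Sum>e\<in>E. const (c e) * e) \<in> B))"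

definition hilbert_function :: "'v set \<Rightarrow> ('v \<Rightarrow> 'k::field) set set \<Rightarrow> nat \<Rightarrow> nat" where
  "hilbert_function V X d = quotient_dim (homog V d) (vanishing_ideal V X \<inter> homog V d)"

definition hilbert_polynomial :: "'v set \<Rightarrow> ('v \<Rightarrow> 'k::field) set set \<Rightarrow> rat poly" where
  "hilbert_polynomial V X =
     (THE h. \<exists>n. \<forall>d\<ge>n. poly h (of_nat d) = of_nat (hilbert_function V X d))"

definition regularity_index :: "'v set \<Rightarrow> ('v \<Rightarrow> 'k::field) set set \<Rightarrow> nat" where
  "regularity_index V X = (LEAST r. \<forall>d\<ge>r.
     poly (hilbert_polynomial V X) (of_nat d) = of_nat (hilbert_function V X d))"

end

theory Submission
  imports Defs
begin

text \<open>
  The whole result rests on the identity of part (c) and on the linear algebra of direct products.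

  The points of the Segre product have the coordinates $\alpha_i\beta_j$.  A form of degree \<open>d\<close> in the
  $t_{i,j}$ becomes a form of degree \<open>d\<close> in either group of variables when the other point is kept
  fixed (\<open>homog_fix_fst\<close>, \<open>homog_fix_snd\<close>), so codewords of the Segre product, seen as matrices, have
  rows and columns in the two factor codes.  Conversely, products of two forms of degree \<open>d\<close> come from
  forms in the $t_{i,j}$ (\<open>homog_segre_product\<close>), so the code of the Segre product contains all the
  matrices of rank one built from codewords, and these span the direct product
  (\<open>direct_product_subset_if_tensors\<close>).  This is \<open>segre_RM_code_direct_product\<close>.

  Parts (b), (d) and (e) then hold for direct products of arbitrary linear codes.  Products of basis
  vectors form a basis (\<open>dim_direct_product\<close>).  Upper bounds for the weights come from products of a
  minimum weight word of one factor with an optimal subcode of the other.  For the lower bounds let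
  \<open>D\<close> be a subcode whose rows span a space of dimension at least \<open>r\<close>.  That space is supported on the
  non-zero columns of \<open>D\<close>, so there are at least $\delta_r(C_2)$ of them, each with at least
  $\delta_1(C_1)$ non-zero entries (\<open>gen_hamming_weight_mult_le_support\<close>).  A non-zero \<open>D\<close> satisfies this
  for \<open>r = 1\<close>; if \<open>D\<close> has dimension 2, then it, or its transpose, satisfies this for \<open>r = 2\<close>, since
  otherwise all matrices in \<open>D\<close> would be multiples of a single matrix of rank one.

  For part (f), the Hilbert function in degree \<open>d\<close> is the dimension of the code of degree \<open>d\<close>.  By
  separating points with products of linear forms it is eventually the number of points, which
  therefore is the Hilbert polynomial.  From the regularity index on, both factor codes are full
  spaces, and so is their direct product.  Part (a) is the injectivity of the Segre map.
\<close>

section \<open>Evaluation of polynomials\<close>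

definition mon_eval :: "('v \<Rightarrow> 'k::comm_ring_1) \<Rightarrow> ('v \<Rightarrow>\<^sub>0 nat) \<Rightarrow> 'k" where
  "mon_eval u m = (\<Prod>v\<in>Poly_Mapping.keys m. u v ^ Poly_Mapping.lookup m v)"

lemma mon_eval_superset:
  assumes "finite A" "Poly_Mapping.keys m \<subseteq> A"
  shows "mon_eval u m = (\<Prod>v\<in>A. u v ^ Poly_Mapping.lookup m v)"
  unfolding mon_eval_def using assms
  by (intro prod.mono_neutral_left) (auto simp: in_keys_iff)

lemma mon_eval_add: "mon_eval u (m + n) = mon_eval u m * mon_eval u n"
proof -
  let ?A = "Poly_Mapping.keys m \<union> Poly_Mapping.keys n"
  have "mon_eval u (m + n) = (\<Prod>v\<in>?A. u v ^ Poly_Mapping.lookup (m + n) v)"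
    by (intro mon_eval_superset) (auto simp: Poly_Mapping.keys_add)
  also have "\<dots> = mon_eval u m * mon_eval u n"
    by (simp add: mon_eval_superset[of ?A] lookup_add power_add prod.distrib)
  finally show ?thesis .
qed

lemma mon_eval_single [simp]: "mon_eval u (Poly_Mapping.single v n) = u v ^ n"
  by (simp add: mon_eval_def)

lemma mon_eval_zero [simp]: "mon_eval u 0 = 1"
  by (simp add: mon_eval_def)

lemma eval_at_superset:
  assumes "finite A" "Poly_Mapping.keys p \<subseteq> A"
  shows "eval_at u p = (\<Sum>m\<in>A. Poly_Mapping.lookup p m * mon_eval u m)"
  unfolding eval_at_def mon_eval_def using assms
  by (intro sum.mono_neutral_left) (auto simp: in_keys_iff)

lemma eval_at_add [simp]: "eval_at u (p + q) = eval_at u p + eval_at u q"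
proof -
  let ?A = "Poly_Mapping.keys p \<union> Poly_Mapping.keys q"
  have "eval_at u (p + q) = (\<Sum>m\<in>?A. Poly_Mapping.lookup (p + q) m * mon_eval u m)"
    by (intro eval_at_superset) (auto simp: Poly_Mapping.keys_add)
  also have "\<dots> = eval_at u p + eval_at u q"
    by (simp add: eval_at_superset[of ?A] lookup_add algebra_simps sum.distrib)
  finally show ?thesis .
qed

lemma eval_at_zero [simp]: "eval_at u 0 = 0"
  by (simp add: eval_at_def)

lemma eval_at_sum [simp]: "eval_at u (\<Sum>a\<in>A. f a) = (\<Sum>a\<in>A. eval_at u (f a))"
  by (induction A rule: infinite_finite_induct) auto

lemma eval_at_diff [simp]: "eval_at u (p - q) = eval_at u p - eval_at u q"
  by (metis add_diff_cancel diff_add_cancel eval_at_add)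

lemma eval_at_single [simp]: "eval_at u (Poly_Mapping.single m c) = c * mon_eval u m"
  by (simp add: eval_at_def mon_eval_def)

lemma sum_monomials:
  "p = (\<Sum>m\<in>Poly_Mapping.keys p. Poly_Mapping.single m (Poly_Mapping.lookup p m))"
proof (rule poly_mapping_eqI)
  fix k
  show "Poly_Mapping.lookup p k = Poly_Mapping.lookup
      (\<Sum>m\<in>Poly_Mapping.keys p. Poly_Mapping.single m (Poly_Mapping.lookup p m)) k"
    by (auto simp: lookup_sum lookup_single when_def sum.delta in_keys_iff)
qed

lemma eval_at_mult [simp]: "eval_at u (p * q) = eval_at u p * eval_at u q"
proof -
  have "eval_at u (p * q) = eval_at u
    ((\<Sum>m\<in>Poly_Mapping.keys p. Poly_Mapping.single m (Poly_Mapping.lookup p m)) *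
     (\<Sum>m\<in>Poly_Mapping.keys q. Poly_Mapping.single m (Poly_Mapping.lookup q m)))"
    by (simp flip: sum_monomials)
  also have "\<dots> = eval_at u (\<Sum>m\<in>Poly_Mapping.keys p. Poly_Mapping.single m (Poly_Mapping.lookup p m)) *
      eval_at u (\<Sum>m\<in>Poly_Mapping.keys q. Poly_Mapping.single m (Poly_Mapping.lookup q m))"
    by (simp add: sum_product mult_single mon_eval_add algebra_simps)
  also have "\<dots> = eval_at u p * eval_at u q"
    by (simp flip: sum_monomials)
  finally show ?thesis .
qed

lemma eval_at_const [simp]: "eval_at u (const c) = c"
  by (simp add: const_def)

lemma eval_at_var [simp]: "eval_at u (var v) = u v"
  by (simp add: var_def)

lemma eval_at_one [simp]: "eval_at u 1 = 1"
  using eval_at_const[of u 1] by (simp add: const_def)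

lemma eval_at_power [simp]: "eval_at u (p ^ n) = eval_at u p ^ n"
  by (induction n) auto

lemma eval_at_prod [simp]: "eval_at u (\<Prod>a\<in>A. f a) = (\<Prod>a\<in>A. eval_at u (f a))"
  by (induction A rule: infinite_finite_induct) auto

section \<open>Homogeneous polynomials\<close>

lemma mon_degree_superset:
  assumes "finite A" "Poly_Mapping.keys m \<subseteq> A"
  shows "mon_degree m = (\<Sum>v\<in>A. Poly_Mapping.lookup m v)"
  unfolding mon_degree_def using assms
  by (intro sum.mono_neutral_left) (auto simp: in_keys_iff)

lemma mon_degree_add: "mon_degree (m + n) = mon_degree m + mon_degree n"
proof -
  let ?A = "Poly_Mapping.keys m \<union> Poly_Mapping.keys n"
  have "mon_degree (m + n) = (\<Sum>v\<in>?A. Poly_Mapping.lookup (m + n) v)"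
    by (intro mon_degree_superset) (auto simp: Poly_Mapping.keys_add)
  also have "\<dots> = mon_degree m + mon_degree n"
    by (simp add: mon_degree_superset[of ?A] lookup_add sum.distrib)
  finally show ?thesis .
qed

lemma mon_degree_single [simp]: "mon_degree (Poly_Mapping.single v n) = n"
  by (simp add: mon_degree_def)

lemma mon_degree_eq_0: "mon_degree m = 0 \<longleftrightarrow> m = 0"
  by (auto simp: mon_degree_def in_keys_iff intro!: poly_mapping_eqI)

lemma homog_zero: "0 \<in> homog V d"
  by (simp add: homog_def poly_ring_def)

lemma homog_add: "p \<in> homog V d \<Longrightarrow> q \<in> homog V d \<Longrightarrow> p + q \<in> homog V d"
  using Poly_Mapping.keys_add[of p q] unfolding homog_def poly_ring_def by blast

lemma homog_sum: "(\<And>a. a \<in> A \<Longrightarrow> f a \<in> homog V d) \<Longrightarrow> (\<Sum>a\<in>A. f a) \<in> homog V d"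
  by (induction A rule: infinite_finite_induct) (auto simp: homog_zero homog_add)

lemma homog_mult:
  assumes "p \<in> homog V d" "q \<in> homog V e"
  shows "p * q \<in> homog V (d + e)"
proof -
  have "Poly_Mapping.keys k \<subseteq> V \<and> mon_degree k = d + e"
    if k_in: "k \<in> Poly_Mapping.keys (p * q)" for k
  proof -
    obtain m n where k: "k = m + n" "m \<in> Poly_Mapping.keys p" "n \<in> Poly_Mapping.keys q"
      using subsetD[OF keys_mult k_in] by auto
    have "Poly_Mapping.keys m \<subseteq> V" "Poly_Mapping.keys n \<subseteq> V" "mon_degree m = d" "mon_degree n = e"
      using assms k by (auto simp: homog_def poly_ring_def)
    then show ?thesis
      using k(1) Poly_Mapping.keys_add[of m n] by (auto simp: mon_degree_add)
  qed
  then show ?thesis by (auto simp: homog_def poly_ring_def)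
qed

lemma homog_single:
  "Poly_Mapping.keys m \<subseteq> V \<Longrightarrow> mon_degree m = d \<Longrightarrow> Poly_Mapping.single m c \<in> homog V d"
  by (auto simp: homog_def poly_ring_def)

lemma homog_const: "const c \<in> homog V 0"
  unfolding const_def by (rule homog_single) (auto simp: mon_degree_def)

lemma homog_var: "v \<in> V \<Longrightarrow> var v \<in> homog V 1"
  unfolding var_def by (rule homog_single) auto

lemma homog_const_mult: "p \<in> homog V d \<Longrightarrow> const c * p \<in> homog V d"
  using homog_mult[OF homog_const] by fastforce

lemma homog_var_mult: "v \<in> V \<Longrightarrow> p \<in> homog V d \<Longrightarrow> var v * p \<in> homog V (Suc d)"
  using homog_mult[OF homog_var] by fastforce

lemma homog_diff:
  fixes p q :: "('v, 'k::comm_ring_1) mpoly"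
  assumes "p \<in> homog V d" "q \<in> homog V d"
  shows "p - q \<in> homog V d"
proof -
  have "const (- 1) = (- 1 :: ('v, 'k) mpoly)"
    by (simp add: const_def single_uminus)
  moreover have "p + const (- 1) * q \<in> homog V d"
    using assms by (intro homog_add homog_const_mult)
  ultimately show ?thesis by simp
qed

lemma homog_power: "p \<in> homog V d \<Longrightarrow> p ^ n \<in> homog V (n * d)"
proof (induction n)
  case 0
  show ?case using homog_const[of 1 V] by (simp add: const_def)
next
  case (Suc n)
  then show ?case using homog_mult[of p V d "p ^ n" "n * d"] by simp
qed

lemma homog_var_power: "v \<in> V \<Longrightarrow> var v ^ n \<in> homog V n"
  using homog_power[OF homog_var, of v V n] by simp

lemma homog_prod:
  "finite A \<Longrightarrow> (\<And>a. a \<in> A \<Longrightarrow> f a \<in> homog V 1) \<Longrightarrow> (\<Prod>a\<in>A. f a) \<in> homog V (card A)"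
proof (induction A rule: finite_induct)
  case empty
  show ?case using homog_const[of 1 V] by (simp add: const_def)
next
  case (insert a A)
  then show ?case using homog_mult[of "f a" V 1] by simp
qed

lemma homog_0E:
  assumes "f \<in> homog V 0"
  obtains c where "f = const c"
proof
  have "Poly_Mapping.keys f \<subseteq> {0}"
    using assms by (auto simp: homog_def mon_degree_eq_0)
  then show "f = const (Poly_Mapping.lookup f 0)"
    by (auto simp: const_def lookup_single when_def in_keys_iff intro!: poly_mapping_eqI)
qed

text \<open>
  Every monomial of positive degree is divisible by some variable, so forms of degree \<open>d + 1\<close>
  are combinations of variables with coefficients of degree \<open>d\<close>.  This turns the degree into an
  induction parameter, and all later facts about forms use only this decomposition.
\<close>

lemma homog_SucE:
  fixes f :: "('v, 'k::comm_ring_1) mpoly"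
  assumes V: "finite V" and f: "f \<in> homog V (Suc d)"
  obtains g where "\<And>v. v \<in> V \<Longrightarrow> g v \<in> homog V d" "f = (\<Sum>v\<in>V. var v * g v)"
proof -
  define T where "T = {f :: ('v, 'k) mpoly. \<exists>g. (\<forall>v\<in>V. g v \<in> homog V d) \<and> f = (\<Sum>v\<in>V. var v * g v)}"
  have zero: "0 \<in> T"
    unfolding T_def by (auto intro!: exI[of _ "\<lambda>_. 0"] homog_zero)
  have add: "p + q \<in> T" if "p \<in> T" "q \<in> T" for p q
  proof -
    obtain g h where "\<forall>v\<in>V. g v \<in> homog V d" "p = (\<Sum>v\<in>V. var v * g v)"
      "\<forall>v\<in>V. h v \<in> homog V d" "q = (\<Sum>v\<in>V. var v * h v)"
      using \<open>p \<in> T\<close> \<open>q \<in> T\<close> unfolding T_def by blast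
    then show ?thesis
      unfolding T_def
      by (auto intro!: exI[of _ "\<lambda>v. g v + h v"] homog_add simp: algebra_simps sum.distrib)
  qed
  have mon: "Poly_Mapping.single m c \<in> T" if "Poly_Mapping.keys m \<subseteq> V" "mon_degree m = Suc d" for m c
  proof -
    have "Poly_Mapping.keys m \<noteq> {}"
      using that(2) by (auto simp: mon_degree_def)
    then obtain v where v: "v \<in> Poly_Mapping.keys m" by blast
    define n where "n = m - Poly_Mapping.single v 1"
    have m: "m = Poly_Mapping.single v 1 + n"
      using v by (intro poly_mapping_eqI)
        (auto simp: n_def lookup_add lookup_minus lookup_single when_def in_keys_iff)
    have "Poly_Mapping.keys n \<subseteq> V"
      using that(1) by (auto simp: m in_keys_iff lookup_add)
    moreover have "mon_degree n = d"
      using that(2) by (simp add: m mon_degree_add)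
    ultimately have h: "Poly_Mapping.single n c \<in> homog V d"
      by (rule homog_single)
    have "Poly_Mapping.single m c = var v * Poly_Mapping.single n c"
      by (simp add: m var_def mult_single)
    also have "\<dots> = (\<Sum>w\<in>V. var w * (if w = v then Poly_Mapping.single n c else 0))"
      using V v that(1) by (subst sum.remove[of V v]) auto
    finally show ?thesis
      unfolding T_def using h
      by (intro CollectI exI[of _ "\<lambda>w. if w = v then Poly_Mapping.single n c else 0"])
        (auto simp: homog_zero)
  qed
  have "(\<Sum>m\<in>A. Poly_Mapping.single m (Poly_Mapping.lookup f m)) \<in> T"
    if "A \<subseteq> Poly_Mapping.keys f" for A
    using finite_subset[OF that finite_keys] that
  proof (induction A rule: finite_induct)
    case (insert m A)
    have "Poly_Mapping.single m (Poly_Mapping.lookup f m) \<in> T"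
      using insert f by (intro mon) (auto simp: homog_def poly_ring_def)
    then show ?case using insert add by simp
  qed (simp add: zero)
  then have "f \<in> T" using sum_monomials[of f] by (metis subset_refl)
  then show ?thesis using that unfolding T_def by blast
qed

lemma eval_at_scale_homog:
  assumes "finite V" "f \<in> homog V d"
  shows "eval_at (\<lambda>v. c * u v) f = c ^ d * eval_at u f"
  using assms(2)
proof (induction d arbitrary: f)
  case 0
  then show ?case by (auto elim: homog_0E)
next
  case (Suc d)
  obtain g where g: "\<And>v. v \<in> V \<Longrightarrow> g v \<in> homog V d" "f = (\<Sum>v\<in>V. var v * g v)"
    using homog_SucE[OF assms(1) Suc.prems] by blast
  show ?case
    by (simp add: g Suc.IH sum_distrib_left algebra_simps)
qed

section \<open>Forms on the Segre variety\<close>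

text \<open>
  On the points \<open>(u i * w j)\<close> of the Segre variety, a form of degree \<open>d\<close> in the $t_{i,j}$ is
  bihomogeneous of bidegree \<open>(d, d)\<close>: with \<open>u\<close> fixed, substituting \<open>u i * y\<^sub>j\<close> for $t_{i,j}$ gives a
  form of degree \<open>d\<close> in the \<open>y\<^sub>j\<close>.  Fixing one factor shows that the rows, and fixing the other that
  the columns, of a codeword of the Segre product are codewords of the factors.
\<close>

lemma homog_fix_fst:
  assumes V: "finite V" and W: "finite W" and "f \<in> homog (V \<times> W) d"
  shows "\<exists>h\<in>homog W d. \<forall>w. eval_at (\<lambda>(i, j). u i * w j) f = eval_at w h"
  using assms(3)
proof (induction d arbitrary: f)
  case 0
  then show ?case by (metis eval_at_const homog_0E homog_const)
next
  case (Suc d)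
  obtain g where g: "\<And>v. v \<in> V \<times> W \<Longrightarrow> g v \<in> homog (V \<times> W) d"
      "f = (\<Sum>v\<in>V \<times> W. var v * g v)"
    using homog_SucE[of "V \<times> W", OF _ Suc.prems] V W by blast
  have "\<forall>v\<in>V \<times> W. \<exists>h\<in>homog W d. \<forall>w. eval_at (\<lambda>(i, j). u i * w j) (g v) = eval_at w h"
    using Suc.IH g(1) by blast
  then obtain h where h: "\<forall>v\<in>V \<times> W. h v \<in> homog W d \<and>
      (\<forall>w. eval_at (\<lambda>(i, j). u i * w j) (g v) = eval_at w (h v))"
    by metis
  show ?case
  proof (intro bexI allI)
    show "(\<Sum>v\<in>V \<times> W. const (u (fst v)) * (var (snd v) * h v)) \<in> homog W (Suc d)"
      using h by (intro homog_sum homog_const_mult homog_var_mult) auto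
    show "eval_at (\<lambda>(i, j). u i * w j) f =
        eval_at w (\<Sum>v\<in>V \<times> W. const (u (fst v)) * (var (snd v) * h v))" for w
      using h by (auto simp: g(2) mult.assoc intro!: sum.cong)
  qed
qed

lemma homog_fix_snd:
  assumes V: "finite V" and W: "finite W" and "f \<in> homog (V \<times> W) d"
  shows "\<exists>g\<in>homog V d. \<forall>u. eval_at (\<lambda>(i, j). u i * w j) f = eval_at u g"
  using assms(3)
proof (induction d arbitrary: f)
  case 0
  then show ?case by (metis eval_at_const homog_0E homog_const)
next
  case (Suc d)
  obtain g where g: "\<And>v. v \<in> V \<times> W \<Longrightarrow> g v \<in> homog (V \<times> W) d"
      "f = (\<Sum>v\<in>V \<times> W. var v * g v)"
    using homog_SucE[of "V \<times> W", OF _ Suc.prems] V W by blast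
  have "\<forall>v\<in>V \<times> W. \<exists>h\<in>homog V d. \<forall>u. eval_at (\<lambda>(i, j). u i * w j) (g v) = eval_at u h"
    using Suc.IH g(1) by blast
  then obtain h where h: "\<forall>v\<in>V \<times> W. h v \<in> homog V d \<and>
      (\<forall>u. eval_at (\<lambda>(i, j). u i * w j) (g v) = eval_at u (h v))"
    by metis
  show ?case
  proof (intro bexI allI)
    show "(\<Sum>v\<in>V \<times> W. const (w (snd v)) * (var (fst v) * h v)) \<in> homog V (Suc d)"
      using h by (intro homog_sum homog_const_mult homog_var_mult) auto
    show "eval_at (\<lambda>(i, j). u i * w j) f =
        eval_at u (\<Sum>v\<in>V \<times> W. const (w (snd v)) * (var (fst v) * h v))" for u
      using h by (auto simp: g(2) mult_ac intro!: sum.cong)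
  qed
qed

text \<open>
  Conversely, a product of forms in separate variables comes from a form in the $t_{i,j}$ as soon as
  the two degrees agree: each step of the induction takes one variable out of either factor and
  pairs them to some $t_{i,j}$.
\<close>

lemma homog_segre_product:
  assumes V: "finite V" and W: "finite W" and "g \<in> homog V d" "h \<in> homog W d"
  shows "\<exists>f\<in>homog (V \<times> W) d. \<forall>u w. eval_at (\<lambda>(i, j). u i * w j) f = eval_at u g * eval_at w h"
  using assms(3,4)
proof (induction d arbitrary: g h)
  case 0
  obtain a b where "g = const a" "h = const b" using 0 homog_0E by metis
  then show ?case by (intro bexI[of _ "const (a * b)"]) (auto simp: homog_const)
next
  case (Suc d)
  obtain g' where g: "\<And>i. i \<in> V \<Longrightarrow> g' i \<in> homog V d" "g = (\<Sum>i\<in>V. var i * g' i)"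
    using homog_SucE[OF V Suc.prems(1)] by blast
  obtain h' where h: "\<And>j. j \<in> W \<Longrightarrow> h' j \<in> homog W d" "h = (\<Sum>j\<in>W. var j * h' j)"
    using homog_SucE[OF W Suc.prems(2)] by blast
  have "\<forall>v\<in>V \<times> W. \<exists>f\<in>homog (V \<times> W) d. \<forall>u w.
      eval_at (\<lambda>(i, j). u i * w j) f = eval_at u (g' (fst v)) * eval_at w (h' (snd v))"
    using Suc.IH g(1) h(1) by force
  then obtain f where f: "\<forall>v\<in>V \<times> W. f v \<in> homog (V \<times> W) d \<and> (\<forall>u w.
      eval_at (\<lambda>(i, j). u i * w j) (f v) = eval_at u (g' (fst v)) * eval_at w (h' (snd v)))"
    by metis
  show ?case
  proof (intro bexI allI)
    show "(\<Sum>v\<in>V \<times> W. var v * f v) \<in> homog (V \<times> W) (Suc d)"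
      using f by (intro homog_sum homog_var_mult) auto
    show "eval_at (\<lambda>(i, j). u i * w j) (\<Sum>v\<in>V \<times> W. var v * f v) = eval_at u g * eval_at w h" for u w
      using f by (auto simp: g(2) h(2) sum_product sum.cartesian_product mult_ac intro!: sum.cong)
  qed
qed

section \<open>Linear codes with finite support\<close>

lemma sum_fun_apply: "(\<Sum>a\<in>A. f a) x = (\<Sum>a\<in>A. f a x)"
  by (induction A rule: infinite_finite_induct) auto

lemma vec_scale_apply [simp]: "vec_scale c v i = c * v i"
  by (simp add: vec_scale_def)

lemma subspace_coord_space: "code.subspace (coord_space I)"
  by (auto simp: code.subspace_def coord_space_def)

definition unit_vec :: "'i \<Rightarrow> 'i \<Rightarrow> 'k::field" where
  "unit_vec i = (\<lambda>j. if j = i then 1 else 0)"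

lemma coord_space_expand:
  assumes "finite I" "v \<in> coord_space I"
  shows "v = (\<Sum>i\<in>I. vec_scale (v i) (unit_vec i))"
proof
  fix j
  show "v j = (\<Sum>i\<in>I. vec_scale (v i) (unit_vec i)) j"
    using assms by (cases "j \<in> I") (auto simp: sum_fun_apply unit_vec_def coord_space_def
        if_distrib sum.delta cong: if_cong)
qed

lemma unit_vec_in_coord_space: "i \<in> I \<Longrightarrow> unit_vec i \<in> coord_space I"
  by (auto simp: unit_vec_def coord_space_def)

lemma span_unit_vec:
  assumes "finite I"
  shows "code.span (unit_vec ` I) = (coord_space I :: ('i \<Rightarrow> 'k::field) set)"
proof
  show "code.span (unit_vec ` I) \<subseteq> (coord_space I :: ('i \<Rightarrow> 'k) set)"
    by (intro code.span_minimal subspace_coord_space) (auto simp: unit_vec_in_coord_space)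
  show "(coord_space I :: ('i \<Rightarrow> 'k) set) \<subseteq> code.span (unit_vec ` I)"
  proof
    fix v :: "'i \<Rightarrow> 'k" assume "v \<in> coord_space I"
    then have "v = (\<Sum>i\<in>I. vec_scale (v i) (unit_vec i))"
      using coord_space_expand assms by blast
    moreover have "(\<Sum>i\<in>I. vec_scale (v i) (unit_vec i)) \<in> code.span (unit_vec ` I)"
      by (rule code.span_sum, rule code.span_scale, rule code.span_base) simp
    ultimately show "v \<in> code.span (unit_vec ` I)" by simp
  qed
qed

lemma finite_independent_coord_space:
  assumes "finite I" "code.independent B" "B \<subseteq> coord_space I"
  shows "finite B" "card B \<le> card I"
proof -
  have "finite B \<and> card B \<le> card (unit_vec ` I :: (_ \<Rightarrow> 'b) set)"
    using assms by (intro code.independent_span_bound) (auto simp: span_unit_vec)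
  then show "finite B" "card B \<le> card I"
    using card_image_le[OF \<open>finite I\<close>, of unit_vec] by (auto intro: le_trans)
qed

lemma code_basis_exists:
  assumes "finite I" "C \<subseteq> coord_space I" "code.subspace C"
  obtains B where "finite B" "B \<subseteq> C" "code.independent B" "code.span B = C" "card B = code.dim C"
proof -
  obtain B where B: "B \<subseteq> C" "code.independent B" "C \<subseteq> code.span B" "card B = code.dim C"
    using code.basis_exists by blast
  show ?thesis
  proof
    show "finite B" using finite_independent_coord_space[OF assms(1) B(2)] B(1) assms(2) by blast
    show "code.span B = C" using B(1,3) assms(3) code.span_subspace by blast
  qed (use B in auto)
qed

text \<open>
  Stated for families rather than for sets, so that no injectivity has to be checked beforehand: a
  repetition \<open>f a = f b\<close> would itself be a relation, with coefficients \<open>1\<close> and \<open>- 1\<close>.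
\<close>

lemma dim_span_independent_family:
  fixes f :: "'a \<Rightarrow> 'i \<Rightarrow> 'k::field"
  assumes A: "finite A"
    and indep: "\<And>c. (\<Sum>a\<in>A. vec_scale (c a) (f a)) = 0 \<Longrightarrow> \<forall>a\<in>A. c a = 0"
  shows "code.dim (code.span (f ` A)) = card A"
proof -
  have inj: "inj_on f A"
  proof (rule inj_onI, rule ccontr)
    fix a b assume ab: "a \<in> A" "b \<in> A" "f a = f b" "a \<noteq> b"
    \<comment> \<open>The relation \<open>f a - f b = 0\<close>.\<close>
    define c :: "'a \<Rightarrow> 'k" where "c x = (if x = a then 1 else if x = b then - 1 else 0)" for x
    have "(\<Sum>x\<in>A. vec_scale (c x) (f x)) = (\<Sum>x\<in>{a, b}. vec_scale (c x) (f x))"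
      using A ab by (intro sum.mono_neutral_right) (auto simp: c_def)
    also have "\<dots> = 0"
      using ab by (auto simp: c_def fun_eq_iff)
    finally show False using indep ab(1) by (force simp: c_def)
  qed
  have "code.independent (f ` A)"
  proof (rule code.independent_if_scalars_zero)
    fix g :: "('i \<Rightarrow> 'k) \<Rightarrow> 'k" and x
    assume "(\<Sum>x\<in>f ` A. vec_scale (g x) x) = 0" and "x \<in> f ` A"
    then show "g x = 0" using indep[of "g \<circ> f"] inj by (auto simp: sum.reindex)
  qed (use A in auto)
  then show ?thesis
    using inj by (simp add: code.dim_eq_card_independent card_image)
qed

lemma dim_coord_space:
  assumes "finite I"
  shows "code.dim (coord_space I :: ('i \<Rightarrow> 'k::field) set) = card I"
proof -
  have "code.dim (code.span (unit_vec ` I :: ('i \<Rightarrow> 'k) set)) = card I"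
  proof (rule dim_span_independent_family[OF assms])
    fix c :: "'i \<Rightarrow> 'k"
    assume 0: "(\<Sum>i\<in>I. vec_scale (c i) (unit_vec i)) = 0"
    have "c j = (\<Sum>i\<in>I. vec_scale (c i) (unit_vec i)) j" if "j \<in> I" for j
      using that assms
      by (auto simp: sum_fun_apply unit_vec_def if_distrib sum.delta cong: if_cong)
    then show "\<forall>a\<in>I. c a = 0" using 0 by simp
  qed
  then show ?thesis using assms by (simp add: span_unit_vec)
qed

lemma full_dim_eq_coord_space:
  assumes I: "finite I" and C: "C \<subseteq> coord_space I" "code.subspace C" and "code.dim C = card I"
  shows "C = coord_space I"
proof (rule ccontr)
  assume "C \<noteq> coord_space I"
  then obtain v where v: "v \<in> coord_space I" "v \<notin> C" using C by blast
  obtain B where B: "finite B" "B \<subseteq> C" "code.independent B" "code.span B = C" "card B = code.dim C"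
    using code_basis_exists[OF I C] by blast
  have "code.independent (insert v B)"
    using B v by (intro code.independent_insertI) auto
  then have "card (insert v B) \<le> card I"
    using v B C by (intro finite_independent_coord_space[OF I]) auto
  moreover have "v \<notin> B" using v B by blast
  ultimately show False using B assms(4) by simp
qed

section \<open>Generalized Hamming weights\<close>

lemma code_support_subset: "D \<subseteq> coord_space I \<Longrightarrow> code_support D \<subseteq> I"
  by (auto simp: code_support_def coord_space_def)

lemma finite_code_support: "finite I \<Longrightarrow> D \<subseteq> coord_space I \<Longrightarrow> finite (code_support D)"
  using code_support_subset finite_subset by metis

lemma code_support_mono: "D \<subseteq> E \<Longrightarrow> code_support D \<subseteq> code_support E"
  by (auto simp: code_support_def)

text \<open>
  The vectors that vanish outside a given index set form a subspace, so taking spans adds no new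
  coordinates to the support.
\<close>

lemma code_support_span: "code_support (code.span S) = code_support S"
proof
  have "code.span S \<subseteq> coord_space (code_support S)"
    by (intro code.span_minimal subspace_coord_space) (auto simp: code_support_def coord_space_def)
  then show "code_support (code.span S) \<subseteq> code_support S"
    by (rule code_support_subset)
qed (intro code_support_mono code.span_superset)

text \<open>
  Subcodes of dimension larger than \<open>r\<close> also bound the weight from above, since they contain
  subcodes of dimension exactly \<open>r\<close>, whose supports can only be smaller.
\<close>

lemma gen_hamming_weight_le:
  assumes I: "finite I" and D: "D \<subseteq> C" "code.subspace D" "D \<subseteq> coord_space I" and r: "r \<le> code.dim D"
  shows "gen_hamming_weight r C \<le> enat (card (code_support D))"
proof -
  obtain B where B: "finite B" "B \<subseteq> D" "code.independent B" "code.span B = D" "card B = code.dim D"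
    using code_basis_exists[OF I D(3,2)] by blast
  obtain B' where B': "B' \<subseteq> B" "card B' = r"
    using obtain_subset_with_card_n[of r B] r B(5) by auto
  have sub: "code.span B' \<subseteq> D" using B' B code.span_mono by metis
  have "code.dim (code.span B') = r"
    using B' B code.independent_mono by (metis code.dim_span_eq_card_independent)
  then have "gen_hamming_weight r C \<le> enat (card (code_support (code.span B')))"
    unfolding gen_hamming_weight_def using sub D(1)
    by (intro Inf_lower CollectI exI[of _ "code.span B'"]) auto
  also have "\<dots> \<le> enat (card (code_support D))"
    using sub finite_code_support[OF I D(3)] by (auto intro!: card_mono code_support_mono)
  finally show ?thesis .
qed

lemma gen_hamming_weight_attained:
  assumes "gen_hamming_weight r C \<noteq> \<infinity>"
  obtains D where "D \<subseteq> C" "code.subspace D" "code.dim D = r"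
    "gen_hamming_weight r C = enat (card (code_support D))"
proof -
  let ?S = "{enat (card (code_support D)) | D. D \<subseteq> C \<and> code.subspace D \<and> code.dim D = r}"
  \<comment> \<open>The infimum over the empty set is infinite, so a finite weight yields a subcode.\<close>
  have "?S \<noteq> {}"
  proof
    assume "?S = {}"
    then show False
      using assms unfolding gen_hamming_weight_def by (simp only: Inf_empty top_enat_def)
  qed
  then have "Inf ?S = (LEAST x. x \<in> ?S)"
    unfolding Inf_enat_def by (rule if_not_P)
  moreover obtain x where "x \<in> ?S" using \<open>?S \<noteq> {}\<close> by blast
  then have "(LEAST x. x \<in> ?S) \<in> ?S" by (rule LeastI)
  ultimately have "Inf ?S \<in> ?S" by simp
  then show ?thesis using that unfolding gen_hamming_weight_def by blast
qed

lemma gen_hamming_weight_greatest: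
  assumes "\<And>D. D \<subseteq> C \<Longrightarrow> code.subspace D \<Longrightarrow> code.dim D = r \<Longrightarrow> m \<le> enat (card (code_support D))"
  shows "m \<le> gen_hamming_weight r C"
  unfolding gen_hamming_weight_def using assms by (auto intro!: Inf_greatest)

lemma subspace_nonzero_support:
  assumes "code.dim D \<ge> 1" "code.subspace D"
  shows "\<exists>v\<in>D. \<exists>i. v i \<noteq> 0"
proof (rule ccontr)
  assume "\<not> ?thesis"
  then have "D \<subseteq> code.span {}" by (auto simp: fun_eq_iff)
  then show False using code.dim_le_card[of D "{}"] assms(1) by simp
qed

lemma dim_singleton: "v \<noteq> 0 \<Longrightarrow> code.dim {v} = 1"
  by (subst code.dim_eq_card_independent) auto

lemma dim_ge_1:
  assumes "finite I" "C \<subseteq> coord_space I" "code.subspace C" "v \<in> C" "v \<noteq> 0"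
  shows "code.dim C \<ge> 1"
proof -
  obtain B where B: "finite B" "code.span B = C" "card B = code.dim C"
    using code_basis_exists[OF assms(1-3)] by blast
  then show ?thesis using assms(4,5) by (cases "B = {}") (auto simp: Suc_le_eq card_gt_0_iff)
qed

lemma gen_hamming_weight_ge_1:
  assumes "finite I" "C \<subseteq> coord_space I" "r \<ge> 1"
  shows "gen_hamming_weight r C \<ge> 1"
proof (rule gen_hamming_weight_greatest)
  fix D assume D: "D \<subseteq> C" "code.subspace D" "code.dim D = r"
  then have "code_support D \<noteq> {}"
    using subspace_nonzero_support[of D] assms(3) by (auto simp: code_support_def)
  then have "card (code_support D) \<ge> 1"
    using finite_code_support[OF assms(1), of D] D assms(2) by (simp add: Suc_le_eq card_gt_0_iff)
  then show "1 \<le> enat (card (code_support D))" by (simp add: one_enat_def)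
qed

lemma gen_hamming_weight_1_finite:
  assumes "finite I" "C \<subseteq> coord_space I" "code.subspace C" "v \<in> C" "v \<noteq> 0"
  shows "gen_hamming_weight 1 C \<noteq> \<infinity>"
proof -
  have "gen_hamming_weight 1 C \<le> enat (card (code_support C))"
    using assms dim_ge_1[OF assms] by (intro gen_hamming_weight_le[of I]) auto
  then show ?thesis by (metis infinity_ileE)
qed

lemma min_weight_le:
  assumes "finite I" "C \<subseteq> coord_space I" "code.subspace C" "v \<in> C" "v \<noteq> 0"
  shows "gen_hamming_weight 1 C \<le> enat (card {i. v i \<noteq> 0})"
proof -
  have "gen_hamming_weight 1 C \<le> enat (card (code_support (code.span {v})))"
    using assms code.span_minimal[of "{v}" C]
    by (intro gen_hamming_weight_le[of I]) (auto simp: dim_singleton)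
  then show ?thesis by (simp add: code_support_span) (simp add: code_support_def)
qed

section \<open>Direct products of codes\<close>

definition tensor :: "('i \<Rightarrow> 'k::field) \<Rightarrow> ('j \<Rightarrow> 'k) \<Rightarrow> 'i \<times> 'j \<Rightarrow> 'k" where
  "tensor u w = (\<lambda>(i, j). u i * w j)"

lemma tensor_apply [simp]: "tensor u w (i, j) = u i * w j"
  by (simp add: tensor_def)

lemma tensor_eq_0: "tensor u w = 0 \<longleftrightarrow> u = 0 \<or> w = 0"
  by (auto simp: fun_eq_iff)

lemma direct_product_subset: "direct_product_code I J C1 C2 \<subseteq> coord_space (I \<times> J)"
  by (auto simp: direct_product_code_def)

lemma direct_product_row:
  assumes "code.subspace C2" "M \<in> direct_product_code I J C1 C2"
  shows "(\<lambda>j. M (i, j)) \<in> C2"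
proof (cases "i \<in> I")
  case False
  then have "(\<lambda>j. M (i, j)) = 0"
    using assms(2) by (auto simp: direct_product_code_def coord_space_def)
  then show ?thesis using code.subspace_0[OF assms(1)] by simp
qed (use assms in \<open>auto simp: direct_product_code_def\<close>)

lemma direct_product_col:
  assumes "code.subspace C1" "M \<in> direct_product_code I J C1 C2"
  shows "(\<lambda>i. M (i, j)) \<in> C1"
proof (cases "j \<in> J")
  case False
  then have "(\<lambda>i. M (i, j)) = 0"
    using assms(2) by (auto simp: direct_product_code_def coord_space_def)
  then show ?thesis using code.subspace_0[OF assms(1)] by simp
qed (use assms in \<open>auto simp: direct_product_code_def\<close>)

lemma subspace_direct_product:
  fixes C1 :: "('i \<Rightarrow> 'k::field) set" and C2 :: "('j \<Rightarrow> 'k) set"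
  assumes C1: "code.subspace C1" and C2: "code.subspace C2"
  shows "code.subspace (direct_product_code I J C1 C2)"
proof (rule code.subspaceI)
  have [simp]: "(\<lambda>_. 0) \<in> C1" "(\<lambda>_. 0) \<in> C2"
    using code.subspace_0[OF C1] code.subspace_0[OF C2] by (auto simp: zero_fun_def)
  show "0 \<in> direct_product_code I J C1 C2"
    by (auto simp: direct_product_code_def coord_space_def)
next
  fix x y assume "x \<in> direct_product_code I J C1 C2" "y \<in> direct_product_code I J C1 C2"
  then show "x + y \<in> direct_product_code I J C1 C2"
    using code.subspace_add[OF C1] code.subspace_add[OF C2]
    by (auto simp: direct_product_code_def coord_space_def plus_fun_def)
next
  fix c and x assume "x \<in> direct_product_code I J C1 C2"
  then show "vec_scale c x \<in> direct_product_code I J C1 C2"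
    using code.subspace_scale[OF C1] code.subspace_scale[OF C2]
    by (auto simp: direct_product_code_def coord_space_def vec_scale_def)
qed

lemma tensor_in_direct_product:
  assumes C1: "code.subspace C1" "C1 \<subseteq> coord_space I" and C2: "code.subspace C2" "C2 \<subseteq> coord_space J"
    and "u \<in> C1" "w \<in> C2"
  shows "tensor u w \<in> direct_product_code I J C1 C2"
proof -
  have "(\<lambda>j. u i * w j) \<in> C2" for i
    using code.subspace_scale[OF C2(1) \<open>w \<in> C2\<close>, of "u i"] by (simp add: vec_scale_def)
  moreover have "(\<lambda>i. u i * w j) \<in> C1" for j
    using code.subspace_scale[OF C1(1) \<open>u \<in> C1\<close>, of "w j"] by (simp add: vec_scale_def mult.commute)
  ultimately show ?thesis
    using assms by (auto simp: direct_product_code_def coord_space_def)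
qed

text \<open>
  Direct product codes are spanned by the matrices of rank one, by Gaussian elimination: for a pivot
  \<open>M (i0, j0) \<noteq> 0\<close>, the column and the row of \<open>M\<close> through the pivot are codewords \<open>u\<close> and \<open>w\<close> (up to
  scaling), and \<open>M - tensor u w\<close> is a codeword with strictly fewer non-zero rows.
\<close>

lemma direct_product_subset_if_tensors:
  fixes C1 :: "('i \<Rightarrow> 'k::field) set" and C2 :: "('j \<Rightarrow> 'k) set"
  assumes I: "finite I" and C1: "code.subspace C1" "C1 \<subseteq> coord_space I"
    and C2: "code.subspace C2" "C2 \<subseteq> coord_space J"
    and T: "code.subspace T" "\<And>u w. u \<in> C1 \<Longrightarrow> w \<in> C2 \<Longrightarrow> tensor u w \<in> T"
  shows "direct_product_code I J C1 C2 \<subseteq> T"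
proof
  fix M assume "M \<in> direct_product_code I J C1 C2"
  then show "M \<in> T"
  proof (induction "card (fst ` {x. M x \<noteq> 0})" arbitrary: M rule: less_induct)
    case less
    show ?case
    proof (cases "M = 0")
      case True
      then show ?thesis using code.subspace_0[OF T(1)] by simp
    next
      case False
      then obtain i0 j0 where p: "M (i0, j0) \<noteq> 0" by (auto simp: fun_eq_iff)
      \<comment> \<open>The pivot is divided out of the row only, so that the product agrees with \<open>M\<close> in
        the row \<open>i0\<close>.\<close>
      define u where "u = (\<lambda>i. M (i, j0))"
      define w where "w = vec_scale (1 / M (i0, j0)) (\<lambda>j. M (i0, j))"
      have u: "u \<in> C1"
        unfolding u_def using less.prems C1 by (intro direct_product_col)
      have w: "w \<in> C2"
        unfolding w_def using less.prems C2
        by (intro direct_product_row code.subspace_scale)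
      let ?N = "M - tensor u w"
      have "?N \<in> direct_product_code I J C1 C2"
        using less.prems tensor_in_direct_product[OF C1 C2 u w]
        by (intro code.subspace_diff subspace_direct_product C1 C2)
      moreover have "card (fst ` {x. ?N x \<noteq> 0}) < card (fst ` {x. M x \<noteq> 0})"
      proof (rule psubset_card_mono)
        have "fst ` {x. M x \<noteq> 0} \<subseteq> I"
          using less.prems direct_product_subset by (force simp: coord_space_def)
        then show "finite (fst ` {x. M x \<noteq> 0})" using I finite_subset by blast
        have row: "?N (i0, j) = 0" for j
          using p by (simp add: u_def w_def)
        have "i \<in> fst ` {x. M x \<noteq> 0}" if "?N (i, j) \<noteq> 0" for i j
        proof (rule ccontr)
          assume "\<not> ?thesis"
          then have "M (i, j') = 0" for j' by force
          then show False using that by (simp add: u_def)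
        qed
        then have "fst ` {x. ?N x \<noteq> 0} \<subseteq> fst ` {x. M x \<noteq> 0}" by auto
        moreover have "i0 \<in> fst ` {x. M x \<noteq> 0}" using p by force
        moreover have "i0 \<notin> fst ` {x. ?N x \<noteq> 0}" using row by auto
        ultimately show "fst ` {x. ?N x \<noteq> 0} \<subset> fst ` {x. M x \<noteq> 0}" by blast
      qed
      ultimately have "?N \<in> T" using less.hyps by blast
      then have "?N + tensor u w \<in> T"
        using T u w by (intro code.subspace_add)
      then show ?thesis by simp
    qed
  qed
qed

lemma tensor_sum_scale:
  "tensor (\<Sum>a\<in>A. vec_scale (c a) (f a)) (\<Sum>b\<in>B. vec_scale (d b) (g b)) =
     (\<Sum>(a, b)\<in>A \<times> B. vec_scale (c a * d b) (tensor (f a) (g b)))"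
  by (auto simp: fun_eq_iff sum_fun_apply sum_product sum.cartesian_product mult_ac intro!: sum.cong)

text \<open>
  Products of basis vectors form a basis.  They span by the elimination argument; a relation among
  them can be read first as a relation among the second factors, for every fixed row \<open>i\<close>, and then
  as relations among the first factors.
\<close>

lemma dim_direct_product:
  fixes C1 :: "('i \<Rightarrow> 'k::field) set" and C2 :: "('j \<Rightarrow> 'k) set"
  assumes I: "finite I" and C1: "code.subspace C1" "C1 \<subseteq> coord_space I"
    and J: "finite J" and C2: "code.subspace C2" "C2 \<subseteq> coord_space J"
  shows "code.dim (direct_product_code I J C1 C2) = code.dim C1 * code.dim C2"
proof -
  obtain B1 where B1: "finite B1" "B1 \<subseteq> C1" "code.independent B1" "code.span B1 = C1" "card B1 = code.dim C1"
    using code_basis_exists[OF I C1(2,1)] by blast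
  obtain B2 where B2: "finite B2" "B2 \<subseteq> C2" "code.independent B2" "code.span B2 = C2" "card B2 = code.dim C2"
    using code_basis_exists[OF J C2(2,1)] by blast
  define t :: "('i \<Rightarrow> 'k) \<times> ('j \<Rightarrow> 'k) \<Rightarrow> 'i \<times> 'j \<Rightarrow> 'k" where "t = (\<lambda>(u, w). tensor u w)"
  have "code.span (t ` (B1 \<times> B2)) = direct_product_code I J C1 C2"
  proof
    show "code.span (t ` (B1 \<times> B2)) \<subseteq> direct_product_code I J C1 C2"
      using B1 B2 tensor_in_direct_product[OF C1 C2]
      by (intro code.span_minimal subspace_direct_product C1 C2) (auto simp: t_def)
    have "tensor u w \<in> code.span (t ` (B1 \<times> B2))" if u: "u \<in> C1" and w: "w \<in> C2" for u w
    proof -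
      obtain c where c: "u = (\<Sum>a\<in>B1. vec_scale (c a) a)"
        using u unfolding B1(4)[symmetric] code.span_finite[OF B1(1)] by blast
      obtain d where d: "w = (\<Sum>b\<in>B2. vec_scale (d b) b)"
        using w unfolding B2(4)[symmetric] code.span_finite[OF B2(1)] by blast
      have "tensor u w = (\<Sum>x\<in>B1 \<times> B2. vec_scale (c (fst x) * d (snd x)) (t x))"
        unfolding c d tensor_sum_scale by (simp add: t_def case_prod_beta)
      also have "\<dots> \<in> code.span (t ` (B1 \<times> B2))"
        by (rule code.span_sum, rule code.span_scale, rule code.span_base) simp
      finally show ?thesis .
    qed
    then show "direct_product_code I J C1 C2 \<subseteq> code.span (t ` (B1 \<times> B2))"
      by (intro direct_product_subset_if_tensors I C1 C2) auto
  qed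
  moreover have "code.dim (code.span (t ` (B1 \<times> B2))) = card (B1 \<times> B2)"
  proof (rule dim_span_independent_family)
    fix c assume 0: "(\<Sum>a\<in>B1 \<times> B2. vec_scale (c a) (t a)) = 0"
    have "c (u, w) = 0" if "u \<in> B1" "w \<in> B2" for u w
    proof -
      have "(\<Sum>w\<in>B2. vec_scale (\<Sum>u\<in>B1. c (u, w) * u i) w) = 0" for i
      proof
        fix j
        have "(\<Sum>w\<in>B2. vec_scale (\<Sum>u\<in>B1. c (u, w) * u i) w) j =
            (\<Sum>u\<in>B1. \<Sum>w\<in>B2. c (u, w) * u i * w j)"
          by (subst sum.swap) (simp add: sum_fun_apply sum_distrib_right)
        also have "\<dots> = (\<Sum>a\<in>B1 \<times> B2. vec_scale (c a) (t a)) (i, j)"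
          by (auto simp: sum_fun_apply sum.cartesian_product t_def mult_ac intro!: sum.cong)
        finally show "(\<Sum>w\<in>B2. vec_scale (\<Sum>u\<in>B1. c (u, w) * u i) w) j = 0 j"
          using 0 by simp
      qed
      then have *: "(\<Sum>u\<in>B1. c (u, w) * u i) = 0" for i
        using code.independentD[OF B2(3,1) subset_refl _ \<open>w \<in> B2\<close>,
            of "\<lambda>w. \<Sum>u\<in>B1. c (u, w) * u i"] by simp
      have "(\<Sum>u\<in>B1. vec_scale (c (u, w)) u) = 0"
        using * by (auto simp: fun_eq_iff sum_fun_apply)
      then show ?thesis
        using code.independentD[OF B1(3,1) subset_refl _ \<open>u \<in> B1\<close>, of "\<lambda>u. c (u, w)"] by simp
    qed
    then show "\<forall>a\<in>B1 \<times> B2. c a = 0" by auto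
  qed (use B1 B2 in auto)
  ultimately show ?thesis using B1 B2 by (simp add: card_cartesian_product)
qed

section \<open>Weights of direct products\<close>

text \<open>
  For a word \<open>u\<close> of minimum weight in \<open>C1\<close> and an optimal \<open>r\<close>-dimensional subcode \<open>D2\<close> of \<open>C2\<close>,
  the products of \<open>u\<close> with the elements of \<open>D2\<close> form an \<open>r\<close>-dimensional subcode supported on a
  rectangle.
\<close>

lemma gen_hamming_weight_direct_product_le:
  fixes C1 :: "('i \<Rightarrow> 'k::field) set" and C2 :: "('j \<Rightarrow> 'k) set"
  assumes I: "finite I" and C1: "code.subspace C1" "C1 \<subseteq> coord_space I" "C1 \<noteq> {0}"
    and J: "finite J" and C2: "code.subspace C2" "C2 \<subseteq> coord_space J" and r: "r \<ge> 1"
  shows "gen_hamming_weight r (direct_product_code I J C1 C2) \<le>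
    gen_hamming_weight 1 C1 * gen_hamming_weight r C2"
proof (cases "gen_hamming_weight r C2 = \<infinity>")
  case True
  have "gen_hamming_weight 1 C1 \<noteq> 0"
    using gen_hamming_weight_ge_1[OF I C1(2), of 1] by auto
  then have "gen_hamming_weight 1 C1 * gen_hamming_weight r C2 = \<infinity>"
    unfolding True by (simp add: imult_is_infinity)
  then show ?thesis by (simp only: enat_ord_simps)
next
  case False
  obtain D2 where D2: "D2 \<subseteq> C2" "code.subspace D2" "code.dim D2 = r"
      "gen_hamming_weight r C2 = enat (card (code_support D2))"
    using gen_hamming_weight_attained[OF False] by blast
  obtain v where v: "v \<in> C1" "v \<noteq> 0" using C1 code.subspace_0 by blast
  obtain D1 where D1: "D1 \<subseteq> C1" "code.subspace D1" "code.dim D1 = 1"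
      "gen_hamming_weight 1 C1 = enat (card (code_support D1))"
    using gen_hamming_weight_attained[OF gen_hamming_weight_1_finite[OF I C1(2,1) v]] by blast
  obtain u i where u: "u \<in> D1" "u i \<noteq> 0"
    using subspace_nonzero_support[of D1] D1 by auto
  interpret T: Vector_Spaces.linear vec_scale vec_scale "\<lambda>w :: 'j \<Rightarrow> 'k. tensor u w"
    by unfold_locales (auto simp: fun_eq_iff algebra_simps)
  have inj: "inj (\<lambda>w :: 'j \<Rightarrow> 'k. tensor u w)"
    unfolding T.inj_iff_eq_0 using u(2) by (auto simp: tensor_eq_0)
  obtain B2 where B2: "finite B2" "B2 \<subseteq> D2" "code.independent B2" "code.span B2 = D2" "card B2 = code.dim D2"
    using code_basis_exists[OF J _ D2(2)] D2(1) C2(2) by blast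
  let ?D = "tensor u ` D2"
  have "?D = code.span (tensor u ` B2)"
    using B2(4) T.span_image by simp
  moreover have "code.independent (tensor u ` B2)"
    using B2(3) inj by (intro T.independent_injective_image) (auto intro: inj_on_subset)
  ultimately have "code.dim ?D = card (tensor u ` B2)"
    by (simp add: code.dim_eq_card_independent)
  then have dim: "code.dim ?D = r"
    using B2(5) D2(3) inj by (simp add: card_image inj_on_subset)
  have "?D \<subseteq> direct_product_code I J C1 C2"
    using tensor_in_direct_product[OF C1(1,2) C2] u D1(1) D2(1) by auto
  moreover have "?D \<subseteq> coord_space (I \<times> J)"
    using calculation direct_product_subset by blast
  moreover have "code.subspace ?D" using D2(2) T.subspace_image by simp
  ultimately have "gen_hamming_weight r (direct_product_code I J C1 C2) \<le> enat (card (code_support ?D))"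
    using I J dim by (intro gen_hamming_weight_le[of "I \<times> J"]) auto
  also have "card (code_support ?D) \<le> card (code_support D1 \<times> code_support D2)"
    using finite_code_support[OF I, of D1] finite_code_support[OF J, of D2] C1 C2 D1 D2 u
    by (intro card_mono) (auto simp: code_support_def)
  also have "card (code_support D1 \<times> code_support D2) = card (code_support D1) * card (code_support D2)"
    by (simp add: card_cartesian_product)
  finally show ?thesis using D1 D2 by simp
qed

text \<open>
  All rows of all the matrices in \<open>D\<close> contribute, so this can have larger dimension than the row
  space of any single matrix in \<open>D\<close>.
\<close>

definition row_space :: "('i \<times> 'j \<Rightarrow> 'k::field) set \<Rightarrow> ('j \<Rightarrow> 'k) set" where
  "row_space D = code.span {\<lambda>j. M (i, j) | M i. M \<in> D}"

lemma code_support_row_space: "code_support (row_space D) = snd ` code_support D"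
  unfolding row_space_def code_support_span by (auto simp: code_support_def image_iff) force+

lemma row_space_subset:
  assumes "code.subspace C2" "D \<subseteq> direct_product_code I J C1 C2"
  shows "row_space D \<subseteq> C2"
  unfolding row_space_def
proof (rule code.span_minimal)
  show "{\<lambda>j. M (i, j) | M i. M \<in> D} \<subseteq> C2"
    using direct_product_row[OF assms(1) subsetD[OF assms(2)]] by blast
qed (rule assms(1))

lemma subspace_row_space: "code.subspace (row_space D)"
  by (simp add: row_space_def)

text \<open>
  The support of the row space is the set of non-zero columns of \<open>D\<close>, hence there are at least
  \<open>gen_hamming_weight r C2\<close> of these; and each of them contains the support of a non-zero word of
  \<open>C1\<close>.
\<close>

lemma gen_hamming_weight_mult_le_support:
  fixes C1 :: "('i \<Rightarrow> 'k::field) set" and C2 :: "('j \<Rightarrow> 'k) set"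
  assumes I: "finite I" and C1: "code.subspace C1" "C1 \<subseteq> coord_space I"
    and J: "finite J" and C2: "code.subspace C2" "C2 \<subseteq> coord_space J" 
    and D: "D \<subseteq> direct_product_code I J C1 C2" and r: "r \<ge> 1" "r \<le> code.dim (row_space D)"
  shows "gen_hamming_weight 1 C1 * gen_hamming_weight r C2 \<le> enat (card (code_support D))"
proof -
  let ?S = "code_support D" and ?R = "row_space D"
  have fin: "finite ?S"
    using finite_code_support[of "I \<times> J" D] I J D direct_product_subset by blast
  have R: "?R \<subseteq> C2" using row_space_subset[OF C2(1) D] .
  have wr: "gen_hamming_weight r C2 \<le> enat (card (snd ` ?S))"
    unfolding code_support_row_space[symmetric]
    using R C2(2) by (intro gen_hamming_weight_le[OF J R subspace_row_space _ r(2)]) auto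
  have col: "gen_hamming_weight 1 C1 \<le> enat (card {i. (i, j) \<in> ?S})" if j: "j \<in> snd ` ?S" for j
  proof -
    obtain M i where M: "M \<in> D" "M (i, j) \<noteq> 0" using j by (auto simp: code_support_def)
    have "(\<lambda>i. M (i, j)) \<in> C1" using direct_product_col[OF C1(1) subsetD[OF D M(1)]] .
    then have "gen_hamming_weight 1 C1 \<le> enat (card {i. M (i, j) \<noteq> 0})"
      using min_weight_le[OF I C1(2,1)] M by (force simp: fun_eq_iff)
    also have "card {i. M (i, j) \<noteq> 0} \<le> card {i. (i, j) \<in> ?S}"
    proof (rule card_mono)
      show "finite {i. (i, j) \<in> ?S}"
        by (rule finite_subset[OF _ finite_imageI[OF fin, of fst]]) force
    qed (use M in \<open>auto simp: code_support_def\<close>)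
    finally show ?thesis by simp
  qed
  have "?R \<noteq> {0}" using subspace_nonzero_support[of ?R] r subspace_row_space by fastforce
  then have "code_support ?R \<noteq> {}"
    using subspace_nonzero_support[of ?R] r subspace_row_space by (force simp: code_support_def)
  then obtain j where "j \<in> snd ` ?S" unfolding code_support_row_space by blast
  then obtain m where m: "gen_hamming_weight 1 C1 = enat m" using col[of j] enat_ile by blast
  have "gen_hamming_weight 1 C1 * gen_hamming_weight r C2 \<le> enat m * enat (card (snd ` ?S))"
    unfolding m using wr by (intro mult_left_mono) auto
  also have "\<dots> = enat (\<Sum>j\<in>snd ` ?S. m)" by simp
  also have "\<dots> \<le> enat (\<Sum>j\<in>snd ` ?S. card {i. (i, j) \<in> ?S})"
    using col unfolding m enat_ord_simps by (intro sum_mono)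
  also have "(\<Sum>j\<in>snd ` ?S. card {i. (i, j) \<in> ?S}) =
      (\<Sum>j\<in>snd ` ?S. card ((\<lambda>i. (i, j)) ` {i. (i, j) \<in> ?S}))"
    by (intro sum.cong refl card_image[symmetric]) (auto simp: inj_on_def)
  also have "\<dots> = card (\<Union>j\<in>snd ` ?S. (\<lambda>i. (i, j)) ` {i. (i, j) \<in> ?S})"
    using fin by (intro card_UN_disjoint[symmetric]) (auto intro: finite_subset[OF _ fin])
  also have "(\<Union>j\<in>snd ` ?S. (\<lambda>i. (i, j)) ` {i. (i, j) \<in> ?S}) = ?S"
    by force
  finally show ?thesis .
qed

section \<open>Transposition and the second weight\<close>

definition mat_transpose :: "('i \<times> 'j \<Rightarrow> 'k) \<Rightarrow> 'j \<times> 'i \<Rightarrow> 'k" where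
  "mat_transpose M = (\<lambda>(j, i). M (i, j))"

lemma mat_transpose_apply [simp]: "mat_transpose M (j, i) = M (i, j)"
  by (simp add: mat_transpose_def)

lemma mat_transpose_mat_transpose [simp]: "mat_transpose (mat_transpose M) = M"
  by (auto simp: fun_eq_iff)

lemma code_support_mat_transpose: "code_support (mat_transpose ` D) = prod.swap ` code_support D"
  by (auto simp: code_support_def image_iff) 

lemma card_code_support_mat_transpose: "card (code_support (mat_transpose ` D)) = card (code_support D)"
  unfolding code_support_mat_transpose by (intro card_image) (auto simp: inj_on_def)

lemma mat_transpose_direct_product_subset:
  "mat_transpose ` direct_product_code I J C1 C2 \<subseteq> direct_product_code J I C2 C1"
  by (auto simp: direct_product_code_def coord_space_def)

lemma mat_transpose_subspace_dim:
  fixes D :: "('i \<times> 'j \<Rightarrow> 'k::field) set"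
  assumes "code.subspace D"
  shows "code.subspace (mat_transpose ` D)" "code.dim (mat_transpose ` D) = code.dim D"
proof -
  interpret T: Vector_Spaces.linear vec_scale vec_scale "mat_transpose :: ('i \<times> 'j \<Rightarrow> 'k) \<Rightarrow> _"
    by unfold_locales (auto simp: fun_eq_iff algebra_simps)
  show "code.subspace (mat_transpose ` D)" using assms by (rule T.subspace_image)
  have inj: "inj (mat_transpose :: ('i \<times> 'j \<Rightarrow> 'k) \<Rightarrow> _)" by (metis injI mat_transpose_mat_transpose)
  obtain B where B: "B \<subseteq> D" "code.independent B" "D \<subseteq> code.span B" "card B = code.dim D"
    using code.basis_exists by blast
  have "code.span B = D" using B assms code.span_subspace by blast
  then have "mat_transpose ` D = code.span (mat_transpose ` B)" using T.span_image by simp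
  moreover have "code.independent (mat_transpose ` B)"
    using B(2) inj by (intro T.independent_injective_image) (auto intro: inj_on_subset)
  ultimately show "code.dim (mat_transpose ` D) = code.dim D"
    using B(4) inj by (simp add: code.dim_eq_card_independent card_image inj_on_subset)
qed

lemma gen_hamming_weight_mat_transpose_le:
  "gen_hamming_weight r (direct_product_code J I C2 C1) \<le>
    gen_hamming_weight r (direct_product_code I J C1 C2)"
proof (rule gen_hamming_weight_greatest)
  fix D assume D: "D \<subseteq> direct_product_code I J C1 C2" "code.subspace D" "code.dim D = r"
  have "mat_transpose ` D \<subseteq> direct_product_code J I C2 C1"
    using D(1) mat_transpose_direct_product_subset by blast
  then have "gen_hamming_weight r (direct_product_code J I C2 C1) \<le>
      enat (card (code_support (mat_transpose ` D)))"
    unfolding gen_hamming_weight_def using mat_transpose_subspace_dim[OF D(2)] D(3)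
    by (intro Inf_lower CollectI exI[of _ "mat_transpose ` D"]) auto
  then show "gen_hamming_weight r (direct_product_code J I C2 C1) \<le> enat (card (code_support D))"
    by (simp add: card_code_support_mat_transpose)
qed

theorem min_distance_direct_product:
  fixes C1 :: "('i \<Rightarrow> 'k::field) set" and C2 :: "('j \<Rightarrow> 'k) set"
  assumes I: "finite I" and C1: "code.subspace C1" "C1 \<subseteq> coord_space I" "C1 \<noteq> {0}"
    and J: "finite J" and C2: "code.subspace C2" "C2 \<subseteq> coord_space J"
  shows "min_distance (direct_product_code I J C1 C2) = min_distance C1 * min_distance C2"
  unfolding min_distance_def
proof (rule antisym)
  show "gen_hamming_weight 1 (direct_product_code I J C1 C2) \<le> gen_hamming_weight 1 C1 * gen_hamming_weight 1 C2"
    using assms by (intro gen_hamming_weight_direct_product_le) auto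
  show "gen_hamming_weight 1 C1 * gen_hamming_weight 1 C2 \<le> gen_hamming_weight 1 (direct_product_code I J C1 C2)"
  proof (rule gen_hamming_weight_greatest)
    fix D assume D: "D \<subseteq> direct_product_code I J C1 C2" "code.subspace D" "code.dim D = 1"
    obtain M i j where M: "M \<in> D" "M (i, j) \<noteq> 0"
      using subspace_nonzero_support[of D] D by force
    have "(\<lambda>j. M (i, j)) \<in> row_space D"
      unfolding row_space_def using M by (intro code.span_base) auto
    moreover have "(\<lambda>j. M (i, j)) \<noteq> 0" using M by (auto simp: fun_eq_iff)
    ultimately have "1 \<le> code.dim (row_space D)"
      using row_space_subset[OF C2(1) D(1)] C2(2) subspace_row_space
      by (intro dim_ge_1[OF J]) auto
    then show "gen_hamming_weight 1 C1 * gen_hamming_weight 1 C2 \<le> enat (card (code_support D))"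
      using assms D by (intro gen_hamming_weight_mult_le_support) auto
  qed
qed

lemma dim_le_1_span:
  assumes "finite I" "C \<subseteq> coord_space I" "code.subspace C" "code.dim C \<le> 1"
  obtains v where "C = code.span {v}"
proof -
  obtain B where B: "finite B" "code.span B = C" "card B = code.dim C"
    using code_basis_exists[OF assms(1-3)] by blast
  show ?thesis
  proof (cases "B = {}")
    case True
    then have "C = code.span {0}" using B(2) by (simp only: code.span_insert_0)
    then show ?thesis using that by blast
  next
    case False
    then have "card B \<noteq> 0" using B(1) by simp
    then have "card B = 1" using B(3) assms(4) by linarith
    then obtain v where "B = {v}" by (rule card_1_singletonE)
    then show ?thesis using that B(2) by blast
  qed
qed

text \<open>
  If all rows are multiples of \<open>w\<close> and all columns are multiples of \<open>u\<close>, then all the matrices are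
  multiples of \<open>tensor u w\<close>.
\<close>

lemma dim_le_1_if_rank_one:
  fixes C1 :: "('i \<Rightarrow> 'k::field) set" and C2 :: "('j \<Rightarrow> 'k) set"
  assumes rows: "row_space D \<subseteq> code.span {w}"
    and cols: "row_space (mat_transpose ` D) \<subseteq> code.span {u}"
  shows "code.dim D \<le> 1"
proof -
  have "M \<in> code.span {tensor u w}" if M: "M \<in> D" for M
  proof (cases "M = 0")
    case True then show ?thesis by (simp add: code.span_zero)
  next
    case False
    then obtain i0 j0 where p: "M (i0, j0) \<noteq> 0" by (auto simp: fun_eq_iff)
    have "(\<lambda>j. M (i, j)) \<in> code.span {w}" for i
      using M by (intro subsetD[OF rows]) (auto simp: row_space_def intro: code.span_base)
    then have "\<forall>i. \<exists>a. \<forall>j. M (i, j) = a * w j"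
      unfolding code.span_singleton by (simp add: image_iff fun_eq_iff)
    then obtain a where a: "\<And>i j. M (i, j) = a i * w j" by metis
    have "(\<lambda>i. M (i, j0)) \<in> code.span {u}"
      using M by (intro subsetD[OF cols])
        (auto simp: row_space_def intro!: code.span_base exI[of _ "mat_transpose M"] exI[of _ j0])
    then have "\<exists>b. \<forall>i. M (i, j0) = b * u i"
      unfolding code.span_singleton by (simp add: image_iff fun_eq_iff)
    then obtain b where b: "\<And>i. M (i, j0) = b * u i" by blast
    have w0: "w j0 \<noteq> 0" using p a by auto
    have "a i = b * u i / w j0" for i
      using a[of i j0] b[of i] w0 by (simp add: field_simps)
    then have "M = vec_scale (b / w j0) (tensor u w)"
      using a by (auto simp: fun_eq_iff)
    then show ?thesis by (metis code.span_base code.span_scale singletonI)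
  qed
  then have "code.dim D \<le> card {tensor u w}" by (intro code.dim_le_card) auto
  then show ?thesis by simp
qed

text \<open>
  A subcode of dimension 2 has a row space or a column space of dimension at least 2, as otherwise
  it would be contained in a line; either case gives one of the two products as a lower bound.
\<close>

theorem second_weight_direct_product:
  fixes C1 :: "('i \<Rightarrow> 'k::field) set" and C2 :: "('j \<Rightarrow> 'k) set"
  assumes I: "finite I" and C1: "code.subspace C1" "C1 \<subseteq> coord_space I" "C1 \<noteq> {0}"
    and J: "finite J" and C2: "code.subspace C2" "C2 \<subseteq> coord_space J" "C2 \<noteq> {0}"
  shows "gen_hamming_weight 2 (direct_product_code I J C1 C2) =
    min (gen_hamming_weight 1 C1 * gen_hamming_weight 2 C2)
        (gen_hamming_weight 2 C1 * gen_hamming_weight 1 C2)"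
proof (rule antisym)
  have "gen_hamming_weight 2 (direct_product_code J I C2 C1) \<le> gen_hamming_weight 1 C2 * gen_hamming_weight 2 C1"
    using assms by (intro gen_hamming_weight_direct_product_le) auto
  moreover have "gen_hamming_weight 2 (direct_product_code I J C1 C2) \<le> gen_hamming_weight 1 C1 * gen_hamming_weight 2 C2"
    using assms by (intro gen_hamming_weight_direct_product_le) auto
  ultimately show "gen_hamming_weight 2 (direct_product_code I J C1 C2) \<le>
      min (gen_hamming_weight 1 C1 * gen_hamming_weight 2 C2) (gen_hamming_weight 2 C1 * gen_hamming_weight 1 C2)"
    using order_trans[OF gen_hamming_weight_mat_transpose_le] by (simp add: mult.commute)
  show "min (gen_hamming_weight 1 C1 * gen_hamming_weight 2 C2) (gen_hamming_weight 2 C1 * gen_hamming_weight 1 C2)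
      \<le> gen_hamming_weight 2 (direct_product_code I J C1 C2)"
  proof (rule gen_hamming_weight_greatest)
    fix D assume D: "D \<subseteq> direct_product_code I J C1 C2" "code.subspace D" "code.dim D = 2"
    have tD: "mat_transpose ` D \<subseteq> direct_product_code J I C2 C1"
      using D(1) mat_transpose_direct_product_subset by blast
    have sub: "row_space D \<subseteq> coord_space J" "row_space (mat_transpose ` D) \<subseteq> coord_space I"
      using row_space_subset[OF C2(1) D(1)] row_space_subset[OF C1(1) tD] C1 C2 by auto
    consider "2 \<le> code.dim (row_space D)" | "2 \<le> code.dim (row_space (mat_transpose ` D))"
      | "code.dim (row_space D) \<le> 1" "code.dim (row_space (mat_transpose ` D)) \<le> 1" by linarith
    then show "min (gen_hamming_weight 1 C1 * gen_hamming_weight 2 C2) (gen_hamming_weight 2 C1 * gen_hamming_weight 1 C2)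
      \<le> enat (card (code_support D))"
    proof cases
      case 1
      then have "gen_hamming_weight 1 C1 * gen_hamming_weight 2 C2 \<le> enat (card (code_support D))"
        using assms D by (intro gen_hamming_weight_mult_le_support) auto
      then show ?thesis by (simp add: min.coboundedI1)
    next
      case 2
      then have "gen_hamming_weight 1 C2 * gen_hamming_weight 2 C1 \<le> enat (card (code_support (mat_transpose ` D)))"
        using assms tD by (intro gen_hamming_weight_mult_le_support) auto
      then show ?thesis by (simp add: min.coboundedI2 card_code_support_mat_transpose mult.commute)
    next
      case 3
      obtain w where "row_space D = code.span {w}"
        using dim_le_1_span[OF J sub(1) subspace_row_space 3(1)] .
      moreover obtain u where "row_space (mat_transpose ` D) = code.span {u}"
        using dim_le_1_span[OF I sub(2) subspace_row_space 3(2)] .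
      ultimately have "code.dim D \<le> 1" by (intro dim_le_1_if_rank_one) auto
      then show ?thesis using D(3) by simp
    qed
  qed
qed

section \<open>Projective points\<close>

lemma equiv_proj_rel: "equiv (coord_space V - {0}) (proj_rel V :: (('v \<Rightarrow> 'k::field) \<times> _) set)"
proof (rule equivI)
  show "refl_on (coord_space V - {0}) (proj_rel V :: (('v \<Rightarrow> 'k) \<times> _) set)"
    by (auto simp: refl_on_def proj_rel_def intro!: exI[of _ 1])
  show "sym (proj_rel V :: (('v \<Rightarrow> 'k) \<times> _) set)"
  proof (rule symI)
    fix u w :: "'v \<Rightarrow> 'k" assume "(u, w) \<in> proj_rel V"
    then obtain c where c: "u \<in> coord_space V - {0}" "w \<in> coord_space V - {0}" "c \<noteq> 0"
        "w = (\<lambda>i. c * u i)"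
      unfolding proj_rel_def by blast
    have "1 / c \<noteq> 0" "u = (\<lambda>i. 1 / c * w i)" using c(3,4) by auto
    then show "(w, u) \<in> proj_rel V" using c(1,2) unfolding proj_rel_def by blast
  qed
  show "trans (proj_rel V :: (('v \<Rightarrow> 'k) \<times> _) set)"
  proof (rule transI)
    fix u v w :: "'v \<Rightarrow> 'k" assume "(u, v) \<in> proj_rel V" "(v, w) \<in> proj_rel V"
    then obtain c d where "u \<in> coord_space V - {0}" "w \<in> coord_space V - {0}" "c \<noteq> 0" "d \<noteq> 0"
        "v = (\<lambda>i. c * u i)" "w = (\<lambda>i. d * v i)"
      by (auto simp: proj_rel_def)
    then show "(u, w) \<in> proj_rel V"
      by (auto simp: proj_rel_def mult.assoc intro!: exI[of _ "d * c"])
  qed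
qed (auto simp: proj_rel_def)

lemma class_eqI:
  assumes "u \<in> coord_space V" "u \<noteq> 0" "c \<noteq> 0" "\<And>i. w i = c * u i"
  shows "proj_rel V `` {w} = proj_rel V `` {u}"
proof -
  have "w = (\<lambda>i. c * u i)" using assms(4) by auto
  then have "(u, w) \<in> proj_rel V"
    using assms(1-3) by (auto simp: proj_rel_def coord_space_def fun_eq_iff)
  then show ?thesis using equiv_class_eq[OF equiv_proj_rel] by metis
qed

lemma proj_space_rep:
  assumes "p \<in> proj_space V"
  shows "rep p \<in> coord_space V" "rep p \<noteq> 0" "p = proj_rel V `` {rep p}" "rep p \<in> p"
proof -
  obtain u where u: "u \<in> coord_space V - {0}" "p = proj_rel V `` {u}"
    using assms unfolding proj_space_def by (auto elim: quotientE)
  have "u \<in> p" using u equiv_class_self[OF equiv_proj_rel] by metis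
  then show mem: "rep p \<in> p" unfolding rep_def by (rule someI[where P = "\<lambda>x. x \<in> p"])
  have rel: "(u, rep p) \<in> proj_rel V" using mem u(2) by simp
  then show "rep p \<in> coord_space V" "rep p \<noteq> 0" by (auto simp: proj_rel_def)
  show "p = proj_rel V `` {rep p}"
    using u(2) equiv_class_eq[OF equiv_proj_rel rel] by simp
qed

lemma proj_space_memE:
  assumes "p \<in> proj_space V" "u \<in> p"
  obtains c where "c \<noteq> 0" "u = (\<lambda>i. c * rep p i)"
  using assms(2) proj_space_rep(3)[OF assms(1)] that by (auto simp: proj_rel_def)

lemma rep_class:
  assumes "u \<in> coord_space V" "u \<noteq> 0"
  obtains c where "c \<noteq> 0" "rep (proj_rel V `` {u}) = (\<lambda>i. c * u i)"
proof -
  have "u \<in> proj_rel V `` {u}" using assms equiv_class_self[OF equiv_proj_rel, of u V] by auto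
  then have "rep (proj_rel V `` {u}) \<in> proj_rel V `` {u}"
    unfolding rep_def by (rule someI[where P = "\<lambda>x. x \<in> proj_rel V `` {u}"])
  then show ?thesis using that by (auto simp: proj_rel_def)
qed

lemma proj_space_eqI:
  assumes "p \<in> proj_space V" "q \<in> proj_space V" "c \<noteq> 0" "\<And>i. rep q i = c * rep p i"
  shows "p = q"
  using class_eqI[of "rep p" V c "rep q"] assms proj_space_rep[OF assms(1)] proj_space_rep[OF assms(2)]
  by metis

lemma lead_index:
  fixes p :: "(nat \<Rightarrow> 'k::field) set"
  assumes "p \<in> proj_space V"
  shows "rep p (lead_index p) \<noteq> 0" "lead_index p \<in> V"
proof -
  obtain k where "rep p k \<noteq> 0" using proj_space_rep(2)[OF assms] by (auto simp: fun_eq_iff)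
  then show *: "rep p (lead_index p) \<noteq> 0" unfolding lead_index_def by (rule LeastI)
  then show "lead_index p \<in> V" using proj_space_rep(1)[OF assms] by (auto simp: coord_space_def)
qed

lemma tensor_coord_space: "u \<in> coord_space V \<Longrightarrow> w \<in> coord_space W \<Longrightarrow> tensor u w \<in> coord_space (V \<times> W)"
  by (auto simp: coord_space_def)

lemma segre_eq:
  fixes p :: "('v \<Rightarrow> 'k::field) set" and q :: "('w \<Rightarrow> 'k) set"
  assumes p: "p \<in> proj_space V" and q: "q \<in> proj_space W"
  shows "segre V W p q = proj_rel (V \<times> W) `` {tensor (rep p) (rep q)}"
proof -
  have *: "proj_rel (V \<times> W) `` {tensor u w} = proj_rel (V \<times> W) `` {tensor (rep p) (rep q)}"
    if u: "u \<in> p" and w: "w \<in> q" for u w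
  proof -
    obtain c where c: "c \<noteq> 0" "u = (\<lambda>i. c * rep p i)" using proj_space_memE[OF p u] .
    obtain d where d: "d \<noteq> 0" "w = (\<lambda>i. d * rep q i)" using proj_space_memE[OF q w] .
    show ?thesis
      using c d proj_space_rep[OF p] proj_space_rep[OF q]
      by (intro class_eqI[where c = "c * d"] tensor_coord_space) (auto simp: tensor_eq_0)
  qed
  have "segre V W p q = (\<Union>u\<in>p. \<Union>w\<in>q. proj_rel (V \<times> W) `` {tensor u w})"
    by (simp only: segre_def tensor_def)
  also have "\<dots> = (\<Union>u\<in>p. \<Union>w\<in>q. proj_rel (V \<times> W) `` {tensor (rep p) (rep q)})"
    using * by (intro SUP_cong refl)
  also have "\<dots> = proj_rel (V \<times> W) `` {tensor (rep p) (rep q)}"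
    using proj_space_rep(4)[OF p] proj_space_rep(4)[OF q] by blast
  finally show ?thesis .
qed

lemma rep_segre:
  fixes p :: "('v \<Rightarrow> 'k::field) set" and q :: "('w \<Rightarrow> 'k) set"
  assumes p: "p \<in> proj_space V" and q: "q \<in> proj_space W"
  obtains c where "c \<noteq> 0" "rep (segre V W p q) = (\<lambda>x. c * tensor (rep p) (rep q) x)"
proof -
  have t: "tensor (rep p) (rep q) \<in> coord_space (V \<times> W)" "tensor (rep p) (rep q) \<noteq> 0"
    using proj_space_rep[OF p] proj_space_rep[OF q] by (auto simp: tensor_coord_space tensor_eq_0)
  show ?thesis
    by (rule rep_class[OF t], rule that, assumption, simp only: segre_eq[OF p q])
qed

text \<open>
  A non-zero matrix of rank one determines its two factors up to scalars: they are proportional to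
  any non-zero column and any non-zero row.
\<close>

lemma segre_inj:
  fixes p p' :: "('v \<Rightarrow> 'k::field) set" and q q' :: "('w \<Rightarrow> 'k) set"
  assumes p: "p \<in> proj_space V" "p' \<in> proj_space V" and q: "q \<in> proj_space W" "q' \<in> proj_space W"
    and eq: "segre V W p q = segre V W p' q'"
  shows "p = p'" "q = q'"
proof -
  obtain c where c: "c \<noteq> 0" "rep (segre V W p q) = (\<lambda>x. c * tensor (rep p) (rep q) x)"
    using rep_segre[OF p(1) q(1)] .
  obtain d where d: "d \<noteq> 0" "rep (segre V W p' q') = (\<lambda>x. d * tensor (rep p') (rep q') x)"
    using rep_segre[OF p(2) q(2)] .
  have fun_eq: "(\<lambda>x. c * tensor (rep p) (rep q) x) = (\<lambda>x. d * tensor (rep p') (rep q') x)"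
    unfolding c(2)[symmetric] d(2)[symmetric] eq ..
  have *: "c * (rep p i * rep q j) = d * (rep p' i * rep q' j)" for i j
    using fun_cong[OF fun_eq, of "(i, j)"] by simp
  obtain i0 where i0: "rep p i0 \<noteq> 0" using proj_space_rep(2)[OF p(1)] by (auto simp: fun_eq_iff)
  obtain j0 where j0: "rep q j0 \<noteq> 0" using proj_space_rep(2)[OF q(1)] by (auto simp: fun_eq_iff)
  have nz: "rep p' i0 \<noteq> 0" "rep q' j0 \<noteq> 0" using *[of i0 j0] i0 j0 c(1) by auto
  show "p = p'"
  proof (rule proj_space_eqI[OF p, of "c * rep q j0 / (d * rep q' j0)"])
    show "rep p' i = c * rep q j0 / (d * rep q' j0) * rep p i" for i
      using *[of i j0] nz d(1) by (simp add: field_simps)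
  qed (use c d nz j0 in auto)
  show "q = q'"
  proof (rule proj_space_eqI[OF q, of "c * rep p i0 / (d * rep p' i0)"])
    show "rep q' j = c * rep p i0 / (d * rep p' i0) * rep q j" for j
      using *[of i0 j] nz d(1) by (simp add: field_simps)
  qed (use c d nz i0 in auto)
qed

theorem card_segre_product:
  assumes "X1 \<subseteq> proj_space {1..a1}" "X2 \<subseteq> proj_space {1..a2}"
  shows "card (segre_product a1 a2 X1 X2) = card X1 * card X2"
proof -
  have "inj_on (\<lambda>(p, q). segre {1..a1} {1..a2} p q) (X1 \<times> X2)"
  proof (intro inj_onI)
    fix x y assume x: "x \<in> X1 \<times> X2" and y: "y \<in> X1 \<times> X2"
      and eq: "(\<lambda>(p, q). segre {1..a1} {1..a2} p q) x = (\<lambda>(p, q). segre {1..a1} {1..a2} p q) y"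
    have mem: "fst x \<in> proj_space {1..a1}" "fst y \<in> proj_space {1..a1}"
      "snd x \<in> proj_space {1..a2}" "snd y \<in> proj_space {1..a2}"
      using x y assms by auto
    have "segre {1..a1} {1..a2} (fst x) (snd x) = segre {1..a1} {1..a2} (fst y) (snd y)"
      using eq by (simp add: case_prod_beta)
    from segre_inj[OF mem this] show "x = y" by (intro prod_eqI)
  qed
  then show ?thesis
    unfolding segre_product_def by (simp add: card_image card_cartesian_product)
qed

section \<open>Evaluation codes\<close>

text \<open>
  The normalisation is kept as an arbitrary scalar \<open>n i\<close> at the point \<open>i\<close>, since the linear algebra
  of evaluation does not depend on how the scalars are chosen.
\<close>

definition ev_vec :: "'i set \<Rightarrow> ('i \<Rightarrow> 'v \<Rightarrow> 'k::field) \<Rightarrow> ('i \<Rightarrow> 'k) \<Rightarrow> ('v, 'k) mpoly \<Rightarrow> 'i \<Rightarrow> 'k" where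
  "ev_vec I u n f = (\<lambda>i. if i \<in> I then eval_at (u i) f / n i else 0)"

lemma ev_vec_add: "ev_vec I u n (f + g) = ev_vec I u n f + ev_vec I u n g"
  by (auto simp: ev_vec_def fun_eq_iff add_divide_distrib)

lemma ev_vec_zero: "ev_vec I u n 0 = 0"
  by (auto simp: ev_vec_def fun_eq_iff)

lemma ev_vec_const_mult: "ev_vec I u n (const c * f) = vec_scale c (ev_vec I u n f)"
  by (auto simp: ev_vec_def fun_eq_iff)

lemma ev_vec_diff: "ev_vec I u n (f - g) = ev_vec I u n f - ev_vec I u n g"
  by (auto simp: ev_vec_def fun_eq_iff diff_divide_distrib)

lemma ev_vec_sum: "ev_vec I u n (\<Sum>a\<in>A. f a) = (\<Sum>a\<in>A. ev_vec I u n (f a))"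
  by (induction A rule: infinite_finite_induct) (auto simp: ev_vec_zero ev_vec_add)

lemma subspace_ev_vec_homog: "code.subspace (ev_vec I u n ` homog V d)"
proof (rule code.subspaceI)
  show "0 \<in> ev_vec I u n ` homog V d"
    by (rule image_eqI[of _ _ 0]) (simp_all add: ev_vec_zero homog_zero)
next
  fix x y assume "x \<in> ev_vec I u n ` homog V d" "y \<in> ev_vec I u n ` homog V d"
  then obtain f g where "f \<in> homog V d" "g \<in> homog V d" "x = ev_vec I u n f" "y = ev_vec I u n g"
    by blast
  then show "x + y \<in> ev_vec I u n ` homog V d"
    by (intro image_eqI[of _ _ "f + g"]) (simp_all add: ev_vec_add homog_add)
next
  fix c x assume "x \<in> ev_vec I u n ` homog V d"
  then obtain f where "f \<in> homog V d" "x = ev_vec I u n f" by blast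
  then show "vec_scale c x \<in> ev_vec I u n ` homog V d"
    by (intro image_eqI[of _ _ "const c * f"]) (simp_all add: ev_vec_const_mult homog_const_mult)
qed

lemma ev_vec_coord_space: "ev_vec I u n f \<in> coord_space I"
  by (auto simp: ev_vec_def coord_space_def)

lemma RM_code_eq:
  "RM_code a s Q d =
    ev_vec {1..s} (\<lambda>i. rep (Q i)) (\<lambda>i. rep (Q i) (lead_index (Q i)) ^ d) ` homog {1..a} d"
  by (simp add: RM_code_def evaluation_code_def ev_vec_def cong: if_cong)

lemma subspace_RM_code: "code.subspace (RM_code a s Q d)"
  unfolding RM_code_eq by (rule subspace_ev_vec_homog)

lemma RM_code_subset: "RM_code a s Q d \<subseteq> coord_space {1..s}"
  unfolding RM_code_eq using ev_vec_coord_space by blast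

lemma RM_code_nonzero:
  assumes "s \<ge> 1" "Q 1 \<in> proj_space {1..a}"
  shows "RM_code a s Q d \<noteq> {0}"
proof -
  let ?v = "ev_vec {1..s} (\<lambda>i. rep (Q i)) (\<lambda>i. rep (Q i) (lead_index (Q i)) ^ d) (var (lead_index (Q 1)) ^ d)"
  have "?v \<in> RM_code a s Q d"
    unfolding RM_code_eq using lead_index(2)[OF assms(2)] by (intro imageI homog_var_power)
  moreover have "?v 1 \<noteq> 0"
    using assms(1) lead_index(1)[OF assms(2)] by (simp add: ev_vec_def)
  ultimately show ?thesis by (metis singletonD zero_fun_apply)
qed

text \<open>
  The class \<open>segre V W p q\<close> is given by some representative \<open>c * tensor (rep p) (rep q)\<close>.  The
  factor \<open>c ^ d\<close> cancels in the quotient of two forms of degree \<open>d\<close>, and what remains is the product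
  of the two normalisations.
\<close>

lemma segre_RM_code_eq:
  fixes Q R :: "nat \<Rightarrow> (nat \<Rightarrow> 'k::field) set"
  assumes Q: "\<And>i. i \<in> {1..s1} \<Longrightarrow> Q i \<in> proj_space {1..a1}"
    and R: "\<And>j. j \<in> {1..s2} \<Longrightarrow> R j \<in> proj_space {1..a2}"
  shows "segre_RM_code a1 a2 s1 s2 Q R d =
    ev_vec ({1..s1} \<times> {1..s2}) (\<lambda>(i, j). tensor (rep (Q i)) (rep (R j)))
      (\<lambda>(i, j). (rep (Q i) (lead_index (Q i)) * rep (R j) (lead_index (R j))) ^ d) `
      homog ({1..a1} \<times> {1..a2}) d"
  unfolding segre_RM_code_def evaluation_code_def
proof (intro image_cong refl ext)
  fix f :: "(nat \<times> nat, 'k) mpoly" and x :: "nat \<times> nat"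
  assume f: "f \<in> homog ({1..a1} \<times> {1..a2}) d"
  obtain i j where x: "x = (i, j)" by force
  show "(if x \<in> {1..s1} \<times> {1..s2}
       then eval_at (rep (case x of (i, j) \<Rightarrow> segre {1..a1} {1..a2} (Q i) (R j))) f /
            eval_at (rep (case x of (i, j) \<Rightarrow> segre {1..a1} {1..a2} (Q i) (R j)))
              (case x of (i, j) \<Rightarrow> var (lead_index (Q i), lead_index (R j)) ^ d)
       else 0) =
    ev_vec ({1..s1} \<times> {1..s2}) (\<lambda>(i, j). tensor (rep (Q i)) (rep (R j)))
      (\<lambda>(i, j). (rep (Q i) (lead_index (Q i)) * rep (R j) (lead_index (R j))) ^ d) f x"
  proof (cases "i \<in> {1..s1} \<and> j \<in> {1..s2}")
    case True
    then obtain c where c: "c \<noteq> 0"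
      "rep (segre {1..a1} {1..a2} (Q i) (R j)) = (\<lambda>x. c * tensor (rep (Q i)) (rep (R j)) x)"
      using rep_segre[OF Q R] by metis
    have "eval_at (\<lambda>x. c * tensor (rep (Q i)) (rep (R j)) x) f = c ^ d * eval_at (tensor (rep (Q i)) (rep (R j))) f"
      using f by (intro eval_at_scale_homog) auto
    then show ?thesis using True c by (simp add: x ev_vec_def power_mult_distrib)
  qed (auto simp: x ev_vec_def)
qed

text \<open>
  Valid also for \<open>d = 0\<close>, where all codes consist of constants; this matters for the last part of the
  main result, where both regularity indices may be 0.
\<close>

theorem segre_RM_code_direct_product:
  fixes Q R :: "nat \<Rightarrow> (nat \<Rightarrow> 'k::field) set"
  assumes Q: "\<And>i. i \<in> {1..s1} \<Longrightarrow> Q i \<in> proj_space {1..a1}"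
    and R: "\<And>j. j \<in> {1..s2} \<Longrightarrow> R j \<in> proj_space {1..a2}"
  shows "segre_RM_code a1 a2 s1 s2 Q R d =
    direct_product_code {1..s1} {1..s2} (RM_code a1 s1 Q d) (RM_code a2 s2 R d)"
proof -
  let ?al = "\<lambda>i. rep (Q i)" and ?be = "\<lambda>j. rep (R j)"
  define m n where "m i = rep (Q i) (lead_index (Q i)) ^ d"
    and "n j = rep (R j) (lead_index (R j)) ^ d" for i j
  let ?E1 = "ev_vec {1..s1} ?al m" and ?E2 = "ev_vec {1..s2} ?be n"
  define E where "E = ev_vec ({1..s1} \<times> {1..s2}) (\<lambda>(i, j). tensor (?al i) (?be j)) (\<lambda>(i, j). m i * n j)"
  have C1: "RM_code a1 s1 Q d = ?E1 ` homog {1..a1} d" by (simp add: RM_code_eq m_def[abs_def])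
  have C2: "RM_code a2 s2 R d = ?E2 ` homog {1..a2} d" by (simp add: RM_code_eq n_def[abs_def])
  have C: "segre_RM_code a1 a2 s1 s2 Q R d = E ` homog ({1..a1} \<times> {1..a2}) d"
    using segre_RM_code_eq[of s1 Q a1 s2 R a2 d, OF Q R]
    by (simp add: E_def m_def n_def power_mult_distrib)
  show ?thesis
  proof
    show "segre_RM_code a1 a2 s1 s2 Q R d \<subseteq>
        direct_product_code {1..s1} {1..s2} (RM_code a1 s1 Q d) (RM_code a2 s2 R d)"
    proof
      fix M assume "M \<in> segre_RM_code a1 a2 s1 s2 Q R d"
      then obtain f where f: "f \<in> homog ({1..a1} \<times> {1..a2}) d" "M = E f" unfolding C by blast
      have "(\<lambda>j. M (i, j)) \<in> RM_code a2 s2 R d" if i: "i \<in> {1..s1}" for i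
      proof -
        obtain h where h: "h \<in> homog {1..a2} d" "\<And>w. eval_at (tensor (?al i) w) f = eval_at w h"
          using homog_fix_fst[OF _ _ f(1), of "?al i"] unfolding tensor_def by auto
        have "(\<lambda>j. M (i, j)) = ?E2 (const (1 / m i) * h)"
          using i by (auto simp: f(2) E_def ev_vec_def h(2))
        then show ?thesis unfolding C2 using h(1) homog_const_mult by blast
      qed
      moreover have "(\<lambda>i. M (i, j)) \<in> RM_code a1 s1 Q d" if j: "j \<in> {1..s2}" for j
      proof -
        obtain g where g: "g \<in> homog {1..a1} d" "\<And>u. eval_at (tensor u (?be j)) f = eval_at u g"
          using homog_fix_snd[OF _ _ f(1), of "?be j"] unfolding tensor_def by auto
        have "(\<lambda>i. M (i, j)) = ?E1 (const (1 / n j) * g)"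
          using j by (auto simp: f(2) E_def ev_vec_def g(2))
        then show ?thesis unfolding C1 using g(1) homog_const_mult by blast
      qed
      moreover have "M \<in> coord_space ({1..s1} \<times> {1..s2})"
        unfolding f(2) E_def by (rule ev_vec_coord_space)
      ultimately show "M \<in> direct_product_code {1..s1} {1..s2} (RM_code a1 s1 Q d) (RM_code a2 s2 R d)"
        unfolding direct_product_code_def by blast
    qed
    show "direct_product_code {1..s1} {1..s2} (RM_code a1 s1 Q d) (RM_code a2 s2 R d) \<subseteq>
        segre_RM_code a1 a2 s1 s2 Q R d"
    proof (intro direct_product_subset_if_tensors subspace_RM_code RM_code_subset)
      show "code.subspace (segre_RM_code a1 a2 s1 s2 Q R d)"
        unfolding C E_def by (rule subspace_ev_vec_homog)
      fix u w assume "u \<in> RM_code a1 s1 Q d" "w \<in> RM_code a2 s2 R d"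
      then obtain g h where gh: "g \<in> homog {1..a1} d" "u = ?E1 g" "h \<in> homog {1..a2} d" "w = ?E2 h"
        unfolding C1 C2 by blast
      obtain f where f: "f \<in> homog ({1..a1} \<times> {1..a2}) d"
          "\<And>u w. eval_at (tensor u w) f = eval_at u g * eval_at w h"
        using homog_segre_product[OF _ _ gh(1,3)] unfolding tensor_def by auto
      have "tensor u w = E f"
        by (auto simp: fun_eq_iff gh E_def ev_vec_def f(2))
      then show "tensor u w \<in> segre_RM_code a1 a2 s1 s2 Q R d" unfolding C using f(1) by blast
    qed auto
  qed
qed

section \<open>Hilbert functions and the regularity index\<close>

text \<open>
  A form vanishes at all representatives of a point if it vanishes at one of them.  Hence in each
  degree the ideal generated by the vanishing forms contains nothing but vanishing forms.
\<close>

lemma vanishing_ideal_homog: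
  assumes V: "finite V" and X: "X \<subseteq> proj_space V"
  shows "vanishing_ideal V X \<inter> homog V d = {f \<in> homog V d. \<forall>p\<in>X. eval_at (rep p) f = 0}"
proof (intro equalityI subsetI)
  fix f assume f: "f \<in> vanishing_ideal V X \<inter> homog V d"
  then obtain F c where F: "f = (\<Sum>g\<in>F. c g * g)" "\<And>g. g \<in> F \<Longrightarrow> \<forall>p\<in>X. \<forall>u\<in>p. eval_at u g = 0"
    unfolding vanishing_ideal_def ideal_generated_def by blast
  have "eval_at (rep p) f = 0" if p: "p \<in> X" for p
  proof -
    have "rep p \<in> p" using p X proj_space_rep(4) by blast
    then show ?thesis using F p by (auto intro!: sum.neutral)
  qed
  then show "f \<in> {f \<in> homog V d. \<forall>p\<in>X. eval_at (rep p) f = 0}" using f by auto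
next
  fix f assume f: "f \<in> {f \<in> homog V d. \<forall>p\<in>X. eval_at (rep p) f = 0}"
  have "eval_at u f = 0" if p: "p \<in> X" and u: "u \<in> p" for p u
  proof -
    obtain c where c: "u = (\<lambda>i. c * rep p i)" using proj_space_memE[OF subsetD[OF X p] u] by blast
    have "eval_at u f = c ^ d * eval_at (rep p) f"
      unfolding c using f by (intro eval_at_scale_homog[OF V]) auto
    then show ?thesis using f p by simp
  qed
  moreover have "1 \<in> poly_ring V" by (auto simp: poly_ring_def)
  ultimately have "\<exists>F c. f = (\<Sum>g\<in>F. c g * g) \<and> finite F \<and>
      F \<subseteq> {f. (\<exists>d. f \<in> homog V d) \<and> (\<forall>p\<in>X. \<forall>u\<in>p. eval_at u f = 0)} \<and> (\<forall>g\<in>F. c g \<in> poly_ring V)"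
    using f by (intro exI[of _ "{f}"] exI[of _ "\<lambda>_. 1"]) auto
  then show "f \<in> vanishing_ideal V X \<inter> homog V d"
    unfolding vanishing_ideal_def ideal_generated_def using f by blast
qed

text \<open>
  First isomorphism theorem: evaluation is linear on forms, so a set of forms is a basis modulo the
  kernel if and only if its values form a basis of the image.
\<close>

lemma quotient_dim_ev_vec:
  fixes u :: "'i \<Rightarrow> 'v \<Rightarrow> 'k::field"
  assumes I: "finite I"
  shows "quotient_dim (homog V d) {f \<in> homog V d. ev_vec I u n f = 0} = code.dim (ev_vec I u n ` homog V d)"
proof -
  let ?E = "ev_vec I u n" and ?A = "homog V d :: ('v, 'k) mpoly set"
  let ?B = "{f \<in> ?A. ?E f = 0}" and ?C = "ev_vec I u n ` homog V d"
  have lin: "?E (\<Sum>e\<in>F. const (c e) * e) = (\<Sum>e\<in>F. vec_scale (c e) (?E e))" for F c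
    by (simp add: ev_vec_sum ev_vec_const_mult)
  have hom: "(\<Sum>e\<in>F. const (c e) * e) \<in> ?A" if "F \<subseteq> ?A" for F c
    using that by (intro homog_sum homog_const_mult) auto
  show ?thesis
    unfolding quotient_dim_def
  proof (rule the_equality)
    obtain B where B: "finite B" "B \<subseteq> ?C" "code.independent B" "code.span B = ?C" "card B = code.dim ?C"
      using code_basis_exists[OF I _ subspace_ev_vec_homog] ev_vec_coord_space by (metis image_subsetI)
    have "\<forall>b\<in>B. \<exists>g\<in>?A. ?E g = b" using B(2) by auto
    then obtain g where g: "\<And>b. b \<in> B \<Longrightarrow> g b \<in> ?A" "\<And>b. b \<in> B \<Longrightarrow> ?E (g b) = b" by metis
    have inj: "inj_on g B" using g(2) by (metis inj_onI)
    have sum: "(\<Sum>e\<in>g ` B. vec_scale (c e) (?E e)) = (\<Sum>b\<in>B. vec_scale (c (g b)) b)" for c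
      using inj g(2) by (simp add: sum.reindex)
    show "\<exists>E. finite E \<and> E \<subseteq> ?A \<and> card E = code.dim ?C \<and>
        (\<forall>c. (\<Sum>e\<in>E. const (c e) * e) \<in> ?B \<longrightarrow> (\<forall>e\<in>E. c e = 0)) \<and>
        (\<forall>f\<in>?A. \<exists>c. f - (\<Sum>e\<in>E. const (c e) * e) \<in> ?B)"
    proof (intro exI[of _ "g ` B"] conjI allI impI ballI)
      show "finite (g ` B)" "g ` B \<subseteq> ?A" "card (g ` B) = code.dim ?C"
        using B g inj by (auto simp: card_image)
    next
      fix c e assume "(\<Sum>e\<in>g ` B. const (c e) * e) \<in> ?B" and e: "e \<in> g ` B"
      then have "(\<Sum>b\<in>B. vec_scale (c (g b)) b) = 0" using lin sum by simp
      then show "c e = 0"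
        using code.independentD[OF B(3,1) subset_refl, of "\<lambda>b. c (g b)"] e by auto
    next
      fix f assume f: "f \<in> ?A"
      then have "?E f \<in> code.span B" using B(4) by blast
      then obtain c where c: "?E f = (\<Sum>b\<in>B. vec_scale (c b) b)"
        unfolding code.span_finite[OF B(1)] by blast
      have "(\<Sum>e\<in>g ` B. vec_scale (c (?E e)) (?E e)) = ?E f"
        unfolding c sum using g(2) by simp
      then have "?E (f - (\<Sum>e\<in>g ` B. const (c (?E e)) * e)) = 0"
        by (simp add: ev_vec_diff lin)
      moreover have "f - (\<Sum>e\<in>g ` B. const (c (?E e)) * e) \<in> ?A"
        using f g(1) by (intro homog_diff hom) auto
      ultimately show "\<exists>c. f - (\<Sum>e\<in>g ` B. const (c e) * e) \<in> ?B"
        by (intro exI[of _ "\<lambda>e. c (?E e)"]) auto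
    qed
  next
    fix k assume "\<exists>E. finite E \<and> E \<subseteq> ?A \<and> card E = k \<and>
        (\<forall>c. (\<Sum>e\<in>E. const (c e) * e) \<in> ?B \<longrightarrow> (\<forall>e\<in>E. c e = 0)) \<and>
        (\<forall>f\<in>?A. \<exists>c. f - (\<Sum>e\<in>E. const (c e) * e) \<in> ?B)"
    then obtain E where E: "finite E" "E \<subseteq> ?A" "card E = k"
        "\<forall>c. (\<Sum>e\<in>E. const (c e) * e) \<in> ?B \<longrightarrow> (\<forall>e\<in>E. c e = 0)"
        "\<forall>f\<in>?A. \<exists>c. f - (\<Sum>e\<in>E. const (c e) * e) \<in> ?B"
      by (elim exE conjE) (rule that)
    have "code.dim (code.span (?E ` E)) = card E"
    proof (rule dim_span_independent_family[OF E(1)])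
      fix c assume "(\<Sum>e\<in>E. vec_scale (c e) (?E e)) = 0"
      then have "(\<Sum>e\<in>E. const (c e) * e) \<in> ?B" using lin hom[OF E(2)] by simp
      then show "\<forall>e\<in>E. c e = 0" using E(4) by blast
    qed
    moreover have "code.span (?E ` E) = ?C"
    proof
      show "code.span (?E ` E) \<subseteq> ?C"
        using E(2) by (intro code.span_minimal subspace_ev_vec_homog) auto
      show "?C \<subseteq> code.span (?E ` E)"
      proof
        fix v assume "v \<in> ?C"
        then obtain f where f: "f \<in> ?A" "v = ?E f" by blast
        obtain c where "f - (\<Sum>e\<in>E. const (c e) * e) \<in> ?B" using bspec[OF E(5) f(1)] by (elim exE) (rule that)
        then have "v = (\<Sum>e\<in>E. vec_scale (c e) (?E e))" by (simp add: f(2) ev_vec_diff lin)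
        also have "\<dots> \<in> code.span (?E ` E)"
          by (rule code.span_sum, rule code.span_scale, rule code.span_base) simp
        finally show "v \<in> code.span (?E ` E)" .
      qed
    qed
    ultimately show "k = code.dim ?C" using E(3) by simp
  qed
qed

lemma hilbert_function_eq_dim:
  assumes "X \<subseteq> proj_space {1..a}" "bij_betw Q {1..s} X"
  shows "hilbert_function {1..a} X d = code.dim (RM_code a s Q d)"
proof -
  let ?n = "\<lambda>i. rep (Q i) (lead_index (Q i)) ^ d"
  have X: "X = Q ` {1..s}" using assms(2) by (simp add: bij_betw_def)
  have "?n i \<noteq> 0" if "i \<in> {1..s}" for i
  proof -
    have "Q i \<in> proj_space {1..a}" using that X assms(1) by blast
    from lead_index(1)[OF this] show ?thesis by simp
  qed
  then have "ev_vec {1..s} (\<lambda>i. rep (Q i)) ?n f = 0 \<longleftrightarrow> (\<forall>p\<in>X. eval_at (rep p) f = 0)" for f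
    by (auto simp: ev_vec_def fun_eq_iff X)
  then show ?thesis
    unfolding hilbert_function_def vanishing_ideal_homog[OF finite_atLeastAtMost assms(1)]
    using quotient_dim_ev_vec[of "{1..s}" "{1..a}" d "\<lambda>i. rep (Q i)" ?n] by (simp add: RM_code_eq)
qed

text \<open>
  Representatives of distinct points are not proportional, so some minor
  \<open>\<alpha> i * \<beta> j - \<alpha> j * \<beta> i\<close> is non-zero, and the linear form \<open>\<beta> j * x i - \<beta> i * x j\<close> has this minor
  as its value at the first point and vanishes at the second.
\<close>

lemma separating_linear_form:
  fixes p q :: "('v \<Rightarrow> 'k::field) set"
  assumes p: "p \<in> proj_space V" and q: "q \<in> proj_space V" and "p \<noteq> q"
  shows "\<exists>l\<in>homog V 1. eval_at (rep p) l \<noteq> 0 \<and> eval_at (rep q) l = 0"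
proof -
  let ?a = "rep p" and ?b = "rep q"
  have "\<exists>i j. ?a i * ?b j \<noteq> ?a j * ?b i"
  proof (rule ccontr)
    assume "\<not> ?thesis"
    then have *: "?a i * ?b j = ?a j * ?b i" for i j by blast
    obtain k where k: "?a k \<noteq> 0" using proj_space_rep(2)[OF p] by (auto simp: fun_eq_iff)
    have b: "?b j = ?b k / ?a k * ?a j" for j using *[of k j] k by (simp add: field_simps)
    have "?b k \<noteq> 0"
    proof
      assume "?b k = 0"
      then have "?b j = 0" for j using b[of j] by simp
      then show False using proj_space_rep(2)[OF q] by (simp add: fun_eq_iff)
    qed
    then have "?b k / ?a k \<noteq> 0" using k by simp
    then have "p = q" using b by (rule proj_space_eqI[OF p q])
    then show False using assms(3) by simp
  qed
  then obtain i j where ij: "?a i * ?b j \<noteq> ?a j * ?b i" by blast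
  have off: "?a x = 0" "?b x = 0" if "x \<notin> V" for x
    using that proj_space_rep(1)[OF p] proj_space_rep(1)[OF q] by (auto simp: coord_space_def)
  have V: "i \<in> V" "j \<in> V"
    by (rule ccontr, use ij off[of i] in simp) (rule ccontr, use ij off[of j] in simp)
  have form: "const (?b j) * var i - const (?b i) * var j \<in> homog V 1"
    using V by (intro homog_diff homog_const_mult homog_var)
  show ?thesis
    by (rule bexI[OF _ form]) (use ij in \<open>simp add: mult.commute\<close>)
qed

text \<open>
  For each point, the product of linear forms that separate it from the other points, filled up to
  degree \<open>d\<close> with a power of a variable that does not vanish there, evaluates to a non-zero
  multiple of a unit vector.
\<close>

lemma RM_code_full:
  assumes X: "X \<subseteq> proj_space {1..a}" and Q: "bij_betw Q {1..s} X" and d: "s \<le> d"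
  shows "RM_code a s Q d = coord_space {1..s}"
proof
  let ?C = "RM_code a s Q d"
  let ?n = "\<lambda>i. rep (Q i) (lead_index (Q i)) ^ d"
  show "?C \<subseteq> coord_space {1..s}" by (rule RM_code_subset)
  have QX: "Q i \<in> proj_space {1..a}" if "i \<in> {1..s}" for i
    using that X Q by (auto simp: bij_betw_def)
  have "unit_vec i \<in> ?C" if i: "i \<in> {1..s}" for i
  proof -
    have "\<forall>j\<in>{1..s} - {i}. \<exists>l\<in>homog {1..a} 1. eval_at (rep (Q i)) l \<noteq> 0 \<and> eval_at (rep (Q j)) l = 0"
    proof
      fix j assume j: "j \<in> {1..s} - {i}"
      then have "Q i \<noteq> Q j"
        using inj_onD[OF bij_betw_imp_inj_on[OF Q], of i j] i by blast
      then show "\<exists>l\<in>homog {1..a} 1. eval_at (rep (Q i)) l \<noteq> 0 \<and> eval_at (rep (Q j)) l = 0"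
        using separating_linear_form[OF QX[OF i] QX[of j]] j by blast
    qed
    then obtain l where l: "\<And>j. j \<in> {1..s} - {i} \<Longrightarrow> l j \<in> homog {1..a} 1"
      "\<And>j. j \<in> {1..s} - {i} \<Longrightarrow> eval_at (rep (Q i)) (l j) \<noteq> 0 \<and> eval_at (rep (Q j)) (l j) = 0"
      by metis
    \<comment> \<open>The degree is filled up with a variable that does not vanish at \<open>Q i\<close>.\<close>
    define f where "f = (\<Prod>j\<in>{1..s} - {i}. l j) * var (lead_index (Q i)) ^ (d - card ({1..s} - {i}))"
    have "card ({1..s} - {i}) \<le> d" using d card_mono[of "{1..s}" "{1..s} - {i}"] by auto
    then have deg: "card ({1..s} - {i}) + (d - card ({1..s} - {i})) = d" by simp
    have "f \<in> homog {1..a} (card ({1..s} - {i}) + (d - card ({1..s} - {i})))"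
      unfolding f_def
      by (intro homog_mult homog_prod homog_var_power l(1) lead_index(2)[OF QX[OF i]]) auto
    then have f: "f \<in> homog {1..a} d" unfolding deg .
    have nz: "eval_at (rep (Q i)) f \<noteq> 0"
      unfolding f_def using l(2) lead_index(1)[OF QX[OF i]] by simp
    have z: "eval_at (rep (Q j)) f = 0" if "j \<in> {1..s}" "j \<noteq> i" for j
    proof -
      have "(\<Prod>j'\<in>{1..s} - {i}. eval_at (rep (Q j)) (l j')) = 0"
        using l(2)[of j] that by (intro prod_zero bexI[of _ j]) auto
      then show ?thesis by (simp add: f_def)
    qed
    let ?c = "?n i / eval_at (rep (Q i)) f"
    have "unit_vec i = ev_vec {1..s} (\<lambda>i. rep (Q i)) ?n (const ?c * f)"
    proof
      fix j
      show "unit_vec i j = ev_vec {1..s} (\<lambda>i. rep (Q i)) ?n (const ?c * f) j"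
        using i nz z[of j] lead_index(1)[OF QX[OF i]]
        by (cases "j = i") (auto simp: unit_vec_def ev_vec_def)
    qed
    then show ?thesis unfolding RM_code_eq using f homog_const_mult by blast
  qed
  then have "code.span (unit_vec ` {1..s}) \<subseteq> ?C"
    by (intro code.span_minimal subspace_RM_code) auto
  then show "coord_space {1..s} \<subseteq> ?C" by (simp add: span_unit_vec)
qed

text \<open>
  Evaluation codes of large degree are the full space, so the Hilbert function is eventually equal
  to the number of points, and a polynomial is determined by infinitely many of its values.
\<close>

lemma hilbert_polynomial_eq:
  fixes X :: "(nat \<Rightarrow> 'k::field) set set" and Q :: "nat \<Rightarrow> (nat \<Rightarrow> 'k) set"
  assumes X: "X \<subseteq> proj_space {1..a}" and Q: "bij_betw Q {1..s} X"
  shows "hilbert_polynomial {1..a} X = [:of_nat s:]"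
proof -
  have H: "hilbert_function {1..a} X d = s" if "d \<ge> s" for d
    using hilbert_function_eq_dim[OF assms] RM_code_full[OF assms that] by (simp add: dim_coord_space)
  show ?thesis
    unfolding hilbert_polynomial_def
  proof (rule the_equality)
    show "\<exists>n. \<forall>d\<ge>n. poly [:of_nat s :: rat:] (of_nat d) = of_nat (hilbert_function {1..a} X d)"
      using H by (intro exI[of _ s]) auto
    fix h :: "rat poly"
    assume "\<exists>n. \<forall>d\<ge>n. poly h (of_nat d) = of_nat (hilbert_function {1..a} X d)"
    then obtain n where n: "\<And>d. d \<ge> n \<Longrightarrow> poly h (of_nat d) = of_nat (hilbert_function {1..a} X d)" by blast
    have "of_nat ` {max n s..} \<subseteq> {x. poly (h - [:of_nat s:]) x = 0}"
      using n H by auto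
    moreover have "infinite (of_nat ` {max n s..} :: rat set)"
      by (subst finite_image_iff) (auto simp: inj_on_def infinite_Ici)
    ultimately have "infinite {x. poly (h - [:of_nat s:]) x = 0}" using finite_subset by blast
    then have "h - [:of_nat s:] = 0" using poly_roots_finite by blast
    then show "h = [:of_nat s:]" by simp
  qed
qed

text \<open>
  From the regularity index on, the dimension of the evaluation code is the value of the constant
  Hilbert polynomial, that is, the length of the code.
\<close>

theorem RM_code_full_from_regularity:
  fixes X :: "(nat \<Rightarrow> 'k::field) set set" and Q :: "nat \<Rightarrow> (nat \<Rightarrow> 'k) set"
  assumes X: "X \<subseteq> proj_space {1..a}" and Q: "bij_betw Q {1..s} X" and d: "regularity_index {1..a} X \<le> d"
  shows "RM_code a s Q d = coord_space {1..s}"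
proof -
  let ?P = "\<lambda>r. \<forall>d\<ge>r. poly (hilbert_polynomial {1..a} X) (of_nat d) = of_nat (hilbert_function {1..a} X d)"
  have eq: "poly (hilbert_polynomial {1..a} X) (of_nat e) = of_nat (hilbert_function {1..a} X e) \<longleftrightarrow>
      code.dim (RM_code a s Q e) = s" for e
    unfolding hilbert_polynomial_eq[OF X Q] hilbert_function_eq_dim[OF X Q] by auto
  have "?P s" unfolding eq using RM_code_full[OF X Q] by (simp add: dim_coord_space)
  then have "?P (regularity_index {1..a} X)" unfolding regularity_index_def by (rule LeastI)
  then have "code.dim (RM_code a s Q d) = s" using d eq by blast
  then show ?thesis
    by (intro full_dim_eq_coord_space RM_code_subset subspace_RM_code) auto
qed

lemma direct_product_coord_space:
  "direct_product_code I J (coord_space I) (coord_space J) = coord_space (I \<times> J)"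
  by (auto simp: direct_product_code_def coord_space_def)

lemma min_distance_coord_space:
  assumes "finite I" "I \<noteq> {}"
  shows "min_distance (coord_space I :: ('i \<Rightarrow> 'k::field) set) = 1"
  unfolding min_distance_def
proof (rule antisym)
  obtain i where i: "i \<in> I" using assms(2) by blast
  have "(unit_vec i :: 'i \<Rightarrow> 'k) i \<noteq> 0" by (simp add: unit_vec_def)
  then have nz: "(unit_vec i :: 'i \<Rightarrow> 'k) \<noteq> 0" by (metis zero_fun_apply)
  have "gen_hamming_weight 1 (coord_space I :: ('i \<Rightarrow> 'k) set) \<le> enat (card {j. (unit_vec i :: 'i \<Rightarrow> 'k) j \<noteq> 0})"
    using i nz by (intro min_weight_le[OF assms(1)] subspace_coord_space unit_vec_in_coord_space) auto
  also have "{j. (unit_vec i :: 'i \<Rightarrow> 'k) j \<noteq> 0} = {i}" by (auto simp: unit_vec_def)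
  finally show "gen_hamming_weight 1 (coord_space I :: ('i \<Rightarrow> 'k) set) \<le> 1" by (simp add: one_enat_def)
qed (intro gen_hamming_weight_ge_1[OF assms(1) subset_refl] order_refl)

theorem theorem3p1:
  fixes a1 a2 :: nat
    and X1 X2 :: "(nat \<Rightarrow> 'k::{finite, field}) set set"
    and Q R :: "nat \<Rightarrow> (nat \<Rightarrow> 'k) set"
  assumes "a1 > 0" and "a2 > 0"
    and "X1 \<subseteq> proj_space {1..a1}" and "X1 \<noteq> {}"
    and "X2 \<subseteq> proj_space {1..a2}" and "X2 \<noteq> {}"
    and "bij_betw Q {1..card X1} X1"
    and "bij_betw R {1..card X2} X2"
  shows
    "card (segre_product a1 a2 X1 X2) = card X1 * card X2 \<and>
     (\<forall>d\<ge>1. code.dim (segre_RM_code a1 a2 (card X1) (card X2) Q R d) =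
              code.dim (RM_code a1 (card X1) Q d) * code.dim (RM_code a2 (card X2) R d)) \<and>
     (\<forall>d\<ge>1. segre_RM_code a1 a2 (card X1) (card X2) Q R d =
              direct_product_code {1..card X1} {1..card X2}
                (RM_code a1 (card X1) Q d) (RM_code a2 (card X2) R d)) \<and>
     (\<forall>d\<ge>1. min_distance (segre_RM_code a1 a2 (card X1) (card X2) Q R d) =
              min_distance (RM_code a1 (card X1) Q d) * min_distance (RM_code a2 (card X2) R d)) \<and>
     (\<forall>d\<ge>1. gen_hamming_weight 2 (segre_RM_code a1 a2 (card X1) (card X2) Q R d) =
              min (gen_hamming_weight 1 (RM_code a1 (card X1) Q d) *
                     gen_hamming_weight 2 (RM_code a2 (card X2) R d))
                  (gen_hamming_weight 2 (RM_code a1 (card X1) Q d) *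
                     gen_hamming_weight 1 (RM_code a2 (card X2) R d))) \<and>
     (\<forall>d \<ge> max (regularity_index {1..a1} X1) (regularity_index {1..a2} X2).
              min_distance (segre_RM_code a1 a2 (card X1) (card X2) Q R d) = 1)"
proof -
  let ?s1 = "card X1" and ?s2 = "card X2"
  have Q: "Q i \<in> proj_space {1..a1}" if "i \<in> {1..?s1}" for i
    using that assms(3,7) by (auto simp: bij_betw_def)
  have R: "R j \<in> proj_space {1..a2}" if "j \<in> {1..?s2}" for j
    using that assms(5,8) by (auto simp: bij_betw_def)
  have s: "1 \<le> ?s1" "1 \<le> ?s2"
    using assms(4,6,7,8) by (auto simp: bij_betw_def Suc_le_eq)
  have one: "1 \<in> {1..?s1}" "1 \<in> {1..?s2}" using s by auto
  have nz: "RM_code a1 ?s1 Q d \<noteq> {0}" "RM_code a2 ?s2 R d \<noteq> {0}" for d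
    by (rule RM_code_nonzero[where Q = Q, OF s(1) Q[OF one(1)]],
        rule RM_code_nonzero[where Q = R, OF s(2) R[OF one(2)]])
  have prod: "segre_RM_code a1 a2 ?s1 ?s2 Q R d =
      direct_product_code {1..?s1} {1..?s2} (RM_code a1 ?s1 Q d) (RM_code a2 ?s2 R d)" for d
    by (intro segre_RM_code_direct_product Q R)
  show ?thesis
  proof (intro conjI allI impI)
    show "card (segre_product a1 a2 X1 X2) = card X1 * card X2"
      by (intro card_segre_product assms)
  next
    fix d :: nat
    show "code.dim (segre_RM_code a1 a2 ?s1 ?s2 Q R d) =
        code.dim (RM_code a1 ?s1 Q d) * code.dim (RM_code a2 ?s2 R d)"
      unfolding prod by (intro dim_direct_product subspace_RM_code RM_code_subset) auto
  next
    fix d :: nat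
    show "segre_RM_code a1 a2 ?s1 ?s2 Q R d =
        direct_product_code {1..?s1} {1..?s2} (RM_code a1 ?s1 Q d) (RM_code a2 ?s2 R d)"
      by (rule prod)
  next
    fix d :: nat
    show "min_distance (segre_RM_code a1 a2 ?s1 ?s2 Q R d) =
        min_distance (RM_code a1 ?s1 Q d) * min_distance (RM_code a2 ?s2 R d)"
      unfolding prod by (intro min_distance_direct_product subspace_RM_code RM_code_subset nz) auto
  next
    fix d :: nat
    show "gen_hamming_weight 2 (segre_RM_code a1 a2 ?s1 ?s2 Q R d) =
        min (gen_hamming_weight 1 (RM_code a1 ?s1 Q d) * gen_hamming_weight 2 (RM_code a2 ?s2 R d))
            (gen_hamming_weight 2 (RM_code a1 ?s1 Q d) * gen_hamming_weight 1 (RM_code a2 ?s2 R d))"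
      unfolding prod by (intro second_weight_direct_product subspace_RM_code RM_code_subset nz) auto
  next
    fix d assume d: "max (regularity_index {1..a1} X1) (regularity_index {1..a2} X2) \<le> d"
    have "RM_code a1 ?s1 Q d = coord_space {1..?s1}" "RM_code a2 ?s2 R d = coord_space {1..?s2}"
      using d RM_code_full_from_regularity[OF assms(3,7)] RM_code_full_from_regularity[OF assms(5,8)]
      by simp_all
    then have "segre_RM_code a1 a2 ?s1 ?s2 Q R d = coord_space ({1..?s1} \<times> {1..?s2})"
      unfolding prod by (simp only: direct_product_coord_space)
    then show "min_distance (segre_RM_code a1 a2 ?s1 ?s2 Q R d) = 1"
      using s by (simp add: min_distance_coord_space)
  qed
qed

end
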